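(* The language $\{\texttt{0}^n\texttt{1}^n\mid n\ge0\}$ over the alphabet $\{\texttt 0,\texttt 1\}$ is in uniform $\mathsf{TC}^0$ but is not definable by any sentence of $\mathsf{FOC}[+;\mathsf{MOD}]$.
   Context: **The logic $\mathsf{FOC}[+;\mathsf{MOD}]$.** Fix a finite alphabet $\Sigma$. Formulas are interpreted in finite strings $w=w_1\cdots w_n\in\Sigma^*$. There are two sorts. Position variables $p,q,\dots$ range over integers in $[1,n]$. Count variables $x,y,z,\dots$ range over the rational numbers; count terms are $c_0+c_1x_1+\dots+c_kx_k$ with rational constants $c_i$ and count variables $x_i$. Formulas are: $\top$ (true), $\bot$ (false); $Q_a(p)$ for $a\in\Sigma$, true iff $w_p=a$; $\mathsf{MOD}^r_m(p)$ for integers $r\ge0$, $m>0$, true iff $p\equiv r \pmod m$; $t_1=t_2$ and $t_1<t_2$ for count terms $t_1,t_2$; $\phi_1\land\phi_2$, $\phi_1\lor\phi_2$, $\neg\phi_1$; $\exists x.\phi$ and $\forall x.\phi$ for a count variable $x$ (quantifying over the rationals); and $\exists^{=x}p.\phi$ for a count variable $x$ and position variable $p$, true iff $\phi$ is true for exactly $x$ values of $p\in[1,n]$ (this binds $p$ but leaves $x$ free). A sentence is a formula with no free variables. The language defined by a sentence $\sigma$ is $\{w\in\Sigma^*\mid w\models\sigma\}$. **Uniform $\mathsf{TC}^0$.** (Non-uniform) $\mathsf{TC}^0$ is the class of languages decided by families of Boolean circuits with majority gates, unlimited fan-in, polynomial size, and constant depth. Uniform $\mathsf{TC}^0$ consists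 of those decided by such circuit families whose connections can be decided in logarithmic time (DLOGTIME-uniformity, in the sense of Barrington, Immerman and Straubing 1990). *)

theory Defs
  imports Complex_Main "HOL-Library.Landau_Symbols"
begin

section \<open>The logic FOC[+;MOD]\<close>

text \<open>
  Position variables and count variables are two separate name spaces, both indexed by
  natural numbers. \<open>CTerm c [(c\<^sub>1, x\<^sub>1), \<dots>, (c\<^sub>k, x\<^sub>k)]\<close> stands for
  \<open>c + c\<^sub>1 x\<^sub>1 + \<dots> + c\<^sub>k x\<^sub>k\<close>. In \<open>FMod r m p\<close>, \<open>r\<close> is the residue and \<open>m\<close> the modulus.
\<close>

datatype cterm = CTerm rat "(rat \<times> nat) list"

datatype 'a fm =
    FTop
  | FBot
  | FLetter 'a nat
  | FMod nat nat nat
  | FEq cterm cterm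
  | FLess cterm cterm
  | FAnd "'a fm" "'a fm"
  | FOr "'a fm" "'a fm"
  | FNot "'a fm"
  | FEx nat "'a fm"
  | FAll nat "'a fm"
  | FCount nat nat "'a fm"  \<comment> \<open>\<open>FCount x p \<phi>\<close>: exactly \<open>x\<close> positions \<open>p\<close> satisfy \<open>\<phi>\<close>\<close>

fun cterm_val :: "(nat \<Rightarrow> rat) \<Rightarrow> cterm \<Rightarrow> rat" where
  "cterm_val \<beta> (CTerm c cxs) = c + (\<Sum>(d, x)\<leftarrow>cxs. d * \<beta> x)"

fun cterm_vars :: "cterm \<Rightarrow> nat set" where
  "cterm_vars (CTerm c cxs) = snd ` set cxs"

text \<open>
  Positions are numbered from 1, lists from 0. The first assignment interprets the position
  variables, the second one the count variables.
\<close>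

fun sat :: "'a list \<Rightarrow> (nat \<Rightarrow> nat) \<Rightarrow> (nat \<Rightarrow> rat) \<Rightarrow> 'a fm \<Rightarrow> bool" where
  "sat w \<alpha> \<beta> FTop \<longleftrightarrow> True"
| "sat w \<alpha> \<beta> FBot \<longleftrightarrow> False"
| "sat w \<alpha> \<beta> (FLetter a p) \<longleftrightarrow> w ! (\<alpha> p - 1) = a"
| "sat w \<alpha> \<beta> (FMod r m p) \<longleftrightarrow> \<alpha> p mod m = r mod m"
| "sat w \<alpha> \<beta> (FEq t u) \<longleftrightarrow> cterm_val \<beta> t = cterm_val \<beta> u"
| "sat w \<alpha> \<beta> (FLess t u) \<longleftrightarrow> cterm_val \<beta> t < cterm_val \<beta> u"
| "sat w \<alpha> \<beta> (FAnd \<phi> \<psi>) \<longleftrightarrow> sat w \<alpha> \<beta> \<phi> \<and> sat w \<alpha> \<beta> \<psi>"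
| "sat w \<alpha> \<beta> (FOr \<phi> \<psi>) \<longleftrightarrow> sat w \<alpha> \<beta> \<phi> \<or> sat w \<alpha> \<beta> \<psi>"
| "sat w \<alpha> \<beta> (FNot \<phi>) \<longleftrightarrow> \<not> sat w \<alpha> \<beta> \<phi>"
| "sat w \<alpha> \<beta> (FEx x \<phi>) \<longleftrightarrow> (\<exists>v. sat w \<alpha> (\<beta>(x := v)) \<phi>)"
| "sat w \<alpha> \<beta> (FAll x \<phi>) \<longleftrightarrow> (\<forall>v. sat w \<alpha> (\<beta>(x := v)) \<phi>)"
| "sat w \<alpha> \<beta> (FCount x p \<phi>) \<longleftrightarrow>
     \<beta> x = of_nat (card {i \<in> {1..length w}. sat w (\<alpha>(p := i)) \<beta> \<phi>})"

fun free_pos :: "'a fm \<Rightarrow> nat set" where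
  "free_pos FTop = {}"
| "free_pos FBot = {}"
| "free_pos (FLetter a p) = {p}"
| "free_pos (FMod r m p) = {p}"
| "free_pos (FEq t u) = {}"
| "free_pos (FLess t u) = {}"
| "free_pos (FAnd \<phi> \<psi>) = free_pos \<phi> \<union> free_pos \<psi>"
| "free_pos (FOr \<phi> \<psi>) = free_pos \<phi> \<union> free_pos \<psi>"
| "free_pos (FNot \<phi>) = free_pos \<phi>"
| "free_pos (FEx x \<phi>) = free_pos \<phi>"
| "free_pos (FAll x \<phi>) = free_pos \<phi>"
| "free_pos (FCount x p \<phi>) = free_pos \<phi> - {p}"

fun free_count :: "'a fm \<Rightarrow> nat set" where
  "free_count FTop = {}"
| "free_count FBot = {}"
| "free_count (FLetter a p) = {}"
| "free_count (FMod r m p) = {}"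
| "free_count (FEq t u) = cterm_vars t \<union> cterm_vars u"
| "free_count (FLess t u) = cterm_vars t \<union> cterm_vars u"
| "free_count (FAnd \<phi> \<psi>) = free_count \<phi> \<union> free_count \<psi>"
| "free_count (FOr \<phi> \<psi>) = free_count \<phi> \<union> free_count \<psi>"
| "free_count (FNot \<phi>) = free_count \<phi>"
| "free_count (FEx x \<phi>) = free_count \<phi> - {x}"
| "free_count (FAll x \<phi>) = free_count \<phi> - {x}"
| "free_count (FCount x p \<phi>) = insert x (free_count \<phi>)"

text \<open>
  The only syntactic side condition is that moduli are positive: with modulus 0, \<open>FMod\<close>
  would express equality with a fixed position.
\<close>

fun wf_fm :: "'a fm \<Rightarrow> bool" where
  "wf_fm (FMod r m p) \<longleftrightarrow> m > 0"
| "wf_fm (FAnd \<phi> \<psi>) \<longleftrightarrow> wf_fm \<phi> \<and> wf_fm \<psi>"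
| "wf_fm (FOr \<phi> \<psi>) \<longleftrightarrow> wf_fm \<phi> \<and> wf_fm \<psi>"
| "wf_fm (FNot \<phi>) \<longleftrightarrow> wf_fm \<phi>"
| "wf_fm (FEx x \<phi>) \<longleftrightarrow> wf_fm \<phi>"
| "wf_fm (FAll x \<phi>) \<longleftrightarrow> wf_fm \<phi>"
| "wf_fm (FCount x p \<phi>) \<longleftrightarrow> wf_fm \<phi>"
| "wf_fm _ \<longleftrightarrow> True"

definition sentence :: "'a fm \<Rightarrow> bool" where
  "sentence \<sigma> \<longleftrightarrow> wf_fm \<sigma> \<and> free_pos \<sigma> = {} \<and> free_count \<sigma> = {}"

lemma cterm_val_cong: "(\<And>x. x \<in> cterm_vars t \<Longrightarrow> \<beta> x = \<beta>' x) \<Longrightarrow> cterm_val \<beta> t = cterm_val \<beta>' t"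
  by (cases t) (force intro!: arg_cong[where f = sum_list])

lemma sat_cong:
  assumes "\<And>p. p \<in> free_pos \<phi> \<Longrightarrow> \<alpha> p = \<alpha>' p" and "\<And>x. x \<in> free_count \<phi> \<Longrightarrow> \<beta> x = \<beta>' x"
  shows "sat w \<alpha> \<beta> \<phi> \<longleftrightarrow> sat w \<alpha>' \<beta>' \<phi>"
  using assms
proof (induction \<phi> arbitrary: \<alpha> \<alpha>' \<beta> \<beta>')
  case (FEq t u)
  then show ?case using cterm_val_cong[of t \<beta> \<beta>'] cterm_val_cong[of u \<beta> \<beta>'] by simp
next
  case (FLess t u)
  then show ?case using cterm_val_cong[of t \<beta> \<beta>'] cterm_val_cong[of u \<beta> \<beta>'] by simp
next
  case (FAnd \<phi> \<psi>)
  then show ?case by (metis UnCI free_count.simps(7) free_pos.simps(7) sat.simps(7))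
next
  case (FOr \<phi> \<psi>)
  then show ?case by (metis UnCI free_count.simps(8) free_pos.simps(8) sat.simps(8))
next
  case (FNot \<phi>)
  then show ?case by (metis free_count.simps(9) free_pos.simps(9) sat.simps(9))
next
  case (FEx x \<phi>)
  have "sat w \<alpha> (\<beta>(x := v)) \<phi> \<longleftrightarrow> sat w \<alpha>' (\<beta>'(x := v)) \<phi>" for v
    by (rule FEx.IH) (use FEx.prems in auto)
  then show ?case by simp
next
  case (FAll x \<phi>)
  have "sat w \<alpha> (\<beta>(x := v)) \<phi> \<longleftrightarrow> sat w \<alpha>' (\<beta>'(x := v)) \<phi>" for v
    by (rule FAll.IH) (use FAll.prems in auto)
  then show ?case by simp
next
  case (FCount x p \<phi>)
  have "sat w (\<alpha>(p := i)) \<beta> \<phi> \<longleftrightarrow> sat w (\<alpha>'(p := i)) \<beta>' \<phi>" for i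
    by (rule FCount.IH) (use FCount.prems in auto)
  then show ?case using FCount.prems(2)[of x] by simp
qed simp_all

text \<open>The assignments used here are irrelevant for sentences, by \<open>sat_cong\<close>.\<close>

definition fm_lang :: "'a fm \<Rightarrow> 'a list set" where
  "fm_lang \<sigma> = {w. sat w (\<lambda>_. 0) (\<lambda>_. 0) \<sigma>}"


section \<open>Deterministic logarithmic time\<close>

text \<open>
  Turing machines with random access to a read-only input. States and tape symbols are natural
  numbers below \<open>tm_states\<close> and \<open>tm_symbols\<close>; symbol 0 is the blank. Tape 0 is the address tape:
  the cells containing the symbol 1 are the digits 1 of a binary number, least significant digit
  in cell 0. In every step the machine sees the input symbol at that address, or \<open>None\<close> if the
  address exceeds the input. The transition function receives the state, this input symbol and
  the symbols under the heads of all tapes.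
\<close>

datatype isym = Bit bool | Sep

datatype move = Left | Stay | Right

record tm =
  tm_tapes :: nat
  tm_symbols :: nat
  tm_states :: nat
  tm_start :: nat
  tm_accept :: nat
  tm_reject :: nat
  tm_delta :: "nat \<Rightarrow> isym option \<Rightarrow> nat list \<Rightarrow> nat \<times> (nat \<times> move) list"

definition wf_tm :: "tm \<Rightarrow> bool" where
  "wf_tm M \<longleftrightarrow>
     tm_tapes M \<ge> 1 \<and> tm_symbols M \<ge> 2 \<and>
     tm_start M < tm_states M \<and> tm_accept M < tm_states M \<and> tm_reject M < tm_states M \<and>
     tm_accept M \<noteq> tm_reject M \<and>
     (\<forall>q < tm_states M. \<forall>s ss q' acts.
        length ss = tm_tapes M \<and> set ss \<subseteq> {..<tm_symbols M} \<and> tm_delta M q s ss = (q', acts) \<longrightarrow>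
        q' < tm_states M \<and> length acts = tm_tapes M \<and> fst ` set acts \<subseteq> {..<tm_symbols M})"

text \<open>A tape, one-way infinite to the right, is given by its contents and its head position.\<close>

type_synonym tape = "(nat \<Rightarrow> nat) \<times> nat"

fun move_head :: "move \<Rightarrow> nat \<Rightarrow> nat" where
  "move_head Left h = h - 1"
| "move_head Stay h = h"
| "move_head Right h = Suc h"

fun tape_act :: "nat \<times> move \<Rightarrow> tape \<Rightarrow> tape" where
  "tape_act (s, m) (f, h) = (f(h := s), move_head m h)"

definition address :: "tape list \<Rightarrow> nat" where
  "address ts = (\<Sum>j | fst (ts ! 0) j = 1. 2 ^ j)"

definition input_sym :: "isym list \<Rightarrow> tape list \<Rightarrow> isym option" where
  "input_sym w ts = (if address ts < length w then Some (w ! address ts) else None)"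

fun tm_step :: "tm \<Rightarrow> isym list \<Rightarrow> nat \<times> tape list \<Rightarrow> nat \<times> tape list" where
  "tm_step M w (q, ts) =
     (if q = tm_accept M \<or> q = tm_reject M then (q, ts)
      else let (q', acts) = tm_delta M q (input_sym w ts) (map (\<lambda>(f, h). f h) ts)
           in (q', map2 tape_act acts ts))"

definition tm_init :: "tm \<Rightarrow> nat \<times> tape list" where
  "tm_init M = (tm_start M, replicate (tm_tapes M) (\<lambda>_. 0, 0))"

definition tm_decides :: "tm \<Rightarrow> (nat \<Rightarrow> nat) \<Rightarrow> isym list set \<Rightarrow> bool" where
  "tm_decides M T L \<longleftrightarrow>
     (\<forall>w. fst ((tm_step M w ^^ T (length w)) (tm_init M)) =
            (if w \<in> L then tm_accept M else tm_reject M))"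

definition DLOGTIME :: "isym list set set" where
  "DLOGTIME = {L. \<exists>M T. wf_tm M \<and> (\<lambda>n. real (T n)) \<in> O(\<lambda>n. ln (real n)) \<and> tm_decides M T L}"


section \<open>Uniform \<open>TC\<^sup>0\<close>\<close>

text \<open>
  Binary strings are lists over \<open>bool\<close>, the letter 0 being \<open>False\<close> and 1 being \<open>True\<close>.
  A circuit is a directed acyclic graph on nodes named by natural numbers; node 0 is the output.
  \<open>GVar i\<close> is the \<open>i\<close>-th input bit, counted from 0.
\<close>

datatype gate = GConst bool | GVar nat | GNot | GAnd | GOr | GMaj

record circuit =
  nodes :: "nat set"
  label :: "nat \<Rightarrow> gate"
  children :: "nat \<Rightarrow> nat set"

definition edges :: "circuit \<Rightarrow> nat rel" where
  "edges C = {(a, b). a \<in> nodes C \<and> b \<in> children C a}"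

definition wf_circuit :: "nat \<Rightarrow> circuit \<Rightarrow> bool" where
  "wf_circuit n C \<longleftrightarrow>
     finite (nodes C) \<and> 0 \<in> nodes C \<and> acyclic (edges C) \<and>
     (\<forall>a \<in> nodes C. children C a \<subseteq> nodes C \<and>
        (case label C a of
           GConst v \<Rightarrow> children C a = {}
         | GVar i \<Rightarrow> i < n \<and> children C a = {}
         | GNot \<Rightarrow> card (children C a) = 1
         | _ \<Rightarrow> children C a \<noteq> {}))"

text \<open>A majority gate is true iff strictly more than half of its children are.\<close>

definition gate_val :: "circuit \<Rightarrow> bool list \<Rightarrow> (nat \<Rightarrow> bool) \<Rightarrow> nat \<Rightarrow> bool" where
  "gate_val C w val a =
     (case label C a of
        GConst v \<Rightarrow> v
      | GVar i \<Rightarrow> w ! i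
      | GNot \<Rightarrow> (\<forall>b \<in> children C a. \<not> val b)
      | GAnd \<Rightarrow> (\<forall>b \<in> children C a. val b)
      | GOr \<Rightarrow> (\<exists>b \<in> children C a. val b)
      | GMaj \<Rightarrow> 2 * card {b \<in> children C a. val b} > card (children C a))"

text \<open>As the graph is acyclic, the node values are determined by the local conditions below.\<close>

definition circuit_accepts :: "circuit \<Rightarrow> bool list \<Rightarrow> bool" where
  "circuit_accepts C w \<longleftrightarrow> (\<exists>val. (\<forall>a \<in> nodes C. val a = gate_val C w val a) \<and> val 0)"

definition depth_le :: "circuit \<Rightarrow> nat \<Rightarrow> bool" where
  "depth_le C d \<longleftrightarrow> (\<forall>k. edges C ^^ k \<noteq> {} \<longrightarrow> k \<le> d)"

text \<open>
  Polynomial size is required in the form that node names are polynomially bounded numbers, so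
  that names have logarithmically many bits. Up to renaming of nodes, this is a polynomial bound
  on the number of nodes.
\<close>

definition TC0_family :: "(nat \<Rightarrow> circuit) \<Rightarrow> bool" where
  "TC0_family C \<longleftrightarrow>
     (\<forall>n. wf_circuit n (C n)) \<and>
     (\<exists>s k. (\<forall>n. nodes (C n) \<subseteq> {..<s n}) \<and> (\<lambda>n. real (s n)) \<in> O(\<lambda>n. real n ^ k)) \<and>
     (\<exists>d. \<forall>n. depth_le (C n) d)"

definition family_lang :: "(nat \<Rightarrow> circuit) \<Rightarrow> bool list set" where
  "family_lang C = {w. circuit_accepts (C (length w)) w}"

text \<open>Binary representation without redundant zeros, least significant digit first.\<close>

fun binary :: "nat \<Rightarrow> bool list" where
  "binary n = (if n = 0 then [] else odd n # binary (n div 2))"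

declare binary.simps [simp del]

text \<open>
  The tuple \<open>\<langle>t, a, b, y\<rangle>\<close>: since \<open>y\<close> comes last and may contain separators itself, a machine
  need not scan it.
\<close>

definition encode :: "nat \<Rightarrow> nat \<Rightarrow> nat \<Rightarrow> isym list \<Rightarrow> isym list" where
  "encode t a b y =
     map Bit (binary t) @ [Sep] @ map Bit (binary a) @ [Sep] @ map Bit (binary b) @ [Sep] @ y"

fun gate_type :: "gate \<Rightarrow> nat" where
  "gate_type (GConst v) = 0"
| "gate_type (GVar i) = 1"
| "gate_type GNot = 2"
| "gate_type GAnd = 3"
| "gate_type GOr = 4"
| "gate_type GMaj = 5"

text \<open>
  The direct connection language: \<open>\<langle>t, a, b, y\<rangle>\<close> such that, in the circuit for inputs of
  length \<open>|y|\<close>, node \<open>a\<close> has type \<open>t\<close> and child \<open>b\<close>. For the nodes without children, \<open>b\<close> is the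
  value of the constant or the index of the input bit. As inner nodes have at least one child,
  this language determines the circuits.
\<close>

definition connections :: "circuit \<Rightarrow> nat \<Rightarrow> nat set" where
  "connections C a =
     (case label C a of GConst v \<Rightarrow> {of_bool v} | GVar i \<Rightarrow> {i} | _ \<Rightarrow> children C a)"

definition DCL :: "(nat \<Rightarrow> circuit) \<Rightarrow> isym list set" where
  "DCL C = {encode (gate_type (label (C (length y)) a)) a b y | a b y.
              a \<in> nodes (C (length y)) \<and> b \<in> connections (C (length y)) a}"

definition uniform_TC0 :: "bool list set set" where
  "uniform_TC0 = {family_lang C | C. TC0_family C \<and> DCL C \<in> DLOGTIME}"

end

theory Submission imports Defs begin

text \<open>
  Membership: the strings \<open>0\<^sup>n1\<^sup>n\<close> are those whose first half, rounded up, consists of zeros and at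
  least half of whose letters are ones. This is a circuit of depth 2 with one majority gate. With
  suitable node names, deciding a connection amounts to matching one of seven prefixes, comparing two
  binary numbers for equality and testing \<open>i < |y|\<close> or \<open>2 * i < |y|\<close>, which a machine with random
  access does in logarithmic time by adding \<open>i\<close> or \<open>2 * i\<close> to the address where \<open>y\<close> begins.

  Inexpressibility: count terms do not mention positions, and positions cannot be compared. Hence the
  truth of a sentence is invariant under every permutation of the positions that preserves their
  residues modulo \<open>M\<close>, where \<open>M\<close> is a common multiple of all moduli in the sentence. Exchanging the
  letters at positions \<open>1\<close> and \<open>M + 1\<close> of \<open>0\<^sup>M1\<^sup>M\<close> leads out of the language.
\<close>

section \<open>Invariance under residue-preserving permutations\<close>

text \<open>Any positive common multiple of the moduli would do; for a product,
  \<open>moduli \<phi> dvd M\<close> passes at once to the subformulas.\<close>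

fun moduli :: "'a fm \<Rightarrow> nat" where
  "moduli (FMod r m p) = m"
| "moduli (FAnd \<phi> \<psi>) = moduli \<phi> * moduli \<psi>"
| "moduli (FOr \<phi> \<psi>) = moduli \<phi> * moduli \<psi>"
| "moduli (FNot \<phi>) = moduli \<phi>"
| "moduli (FEx x \<phi>) = moduli \<phi>"
| "moduli (FAll x \<phi>) = moduli \<phi>"
| "moduli (FCount x p \<phi>) = moduli \<phi>"
| "moduli _ = 1"

lemma moduli_pos: "wf_fm \<phi> \<Longrightarrow> moduli \<phi> > 0"
  by (induction \<phi>) auto

text \<open>At a counting quantifier, \<open>\<pi>\<close> restricts to a bijection between the
  satisfying positions of both words, so the counts agree and the same \<open>\<beta>\<close> serves
  on both sides. Positions must stay within the word, as nothing is known of \<open>\<pi>\<close>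
  elsewhere.\<close>

lemma sat_permute:
  assumes \<pi>: "bij_betw \<pi> {1..length w} {1..length w}" and len: "length w' = length w"
    and letter: "\<And>i. i \<in> {1..length w} \<Longrightarrow> w' ! (\<pi> i - 1) = w ! (i - 1)"
    and residue: "\<And>i. i \<in> {1..length w} \<Longrightarrow> \<pi> i mod M = i mod M"
    and "moduli \<phi> dvd M" and "\<And>p. p \<in> free_pos \<phi> \<Longrightarrow> \<alpha> p \<in> {1..length w}"
  shows "sat w' (\<pi> \<circ> \<alpha>) \<beta> \<phi> \<longleftrightarrow> sat w \<alpha> \<beta> \<phi>"
  using assms(5,6)
proof (induction \<phi> arbitrary: \<alpha> \<beta>)
  case (FMod r m p)
  then have "\<pi> (\<alpha> p) mod M mod m = \<alpha> p mod M mod m" using residue[of "\<alpha> p"] by simp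
  then show ?case using FMod.prems by (simp add: mod_mod_cancel)
next
  case (FCount x p \<phi>)
  have "sat w' ((\<pi> \<circ> \<alpha>)(p := \<pi> i)) \<beta> \<phi> \<longleftrightarrow> sat w (\<alpha>(p := i)) \<beta> \<phi>" if "i \<in> {1..length w}" for i
  proof -
    have "(\<pi> \<circ> \<alpha>)(p := \<pi> i) = \<pi> \<circ> \<alpha>(p := i)" by auto
    moreover have "q \<in> free_pos \<phi> \<Longrightarrow> (\<alpha>(p := i)) q \<in> {1..length w}" for q
      using FCount.prems(2)[of q] that by auto
    ultimately show ?thesis using FCount.IH[of "\<alpha>(p := i)" \<beta>] FCount.prems(1)
      by (simp del: fun_upd_apply comp_apply add: o_def)
  qed
  then have "card {i \<in> {1..length w}. sat w (\<alpha>(p := i)) \<beta> \<phi>} =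
      card {i \<in> {1..length w}. sat w' ((\<pi> \<circ> \<alpha>)(p := i)) \<beta> \<phi>}"
    by (intro bij_betw_same_card[OF bij_betw_Collect[OF \<pi>]]) blast
  then show ?case using len by (simp del: One_nat_def comp_apply add: o_def)
next
  case (FAnd \<phi> \<psi>)
  then have "moduli \<phi> dvd M" "moduli \<psi> dvd M" by (auto dest: dvd_mult_left dvd_mult_right)
  then show ?case using FAnd.IH[of \<alpha> \<beta>] FAnd.prems(2) by simp
next
  case (FOr \<phi> \<psi>)
  then have "moduli \<phi> dvd M" "moduli \<psi> dvd M" by (auto dest: dvd_mult_left dvd_mult_right)
  then show ?case using FOr.IH[of \<alpha> \<beta>] FOr.prems(2) by simp
qed (auto simp: letter simp del: One_nat_def)

lemma zeros_ones_not_definable: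
  fixes \<sigma> :: "bool fm"
  assumes "sentence \<sigma>"
  shows "fm_lang \<sigma> \<noteq> {replicate n False @ replicate n True | n. n \<ge> 0}"
proof
  assume L: "fm_lang \<sigma> = {replicate n False @ replicate n True | n. n \<ge> 0}"
  define M where "M = moduli \<sigma>"
  have M: "M > 0" using assms moduli_pos by (auto simp: M_def sentence_def)
  define w where "w = replicate M False @ replicate M True"
  \<comment> \<open>The list indices \<open>0\<close> and \<open>M\<close> are the positions
    \<open>1\<close> and \<open>M + 1\<close>, which \<open>\<pi>\<close> exchanges.\<close>
  define w' where "w' = w[0 := True, M := False]"
  define \<pi> where "\<pi> = (id :: nat \<Rightarrow> nat)(1 := M + 1, M + 1 := 1)"
  have len: "length w = 2 * M" "length w' = 2 * M" by (simp_all add: w_def w'_def)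
  have "bij_betw \<pi> {1..length w} {1..length w}"
    by (rule bij_betw_byWitness[where f' = \<pi>]) (auto simp: \<pi>_def len)
  moreover have "w' ! (\<pi> i - 1) = w ! (i - 1)" if "i \<in> {1..length w}" for i
    using that M by (auto simp: \<pi>_def w'_def w_def len nth_append nth_list_update)
  moreover have "\<pi> i mod M = i mod M" for i
  proof -
    have "(M + 1) mod M = 1 mod M" by (rule mod_add_self1)
    then show ?thesis by (simp only: \<pi>_def fun_upd_apply id_apply split: if_split) simp
  qed
  ultimately have "sat w' (\<pi> \<circ> (\<lambda>_. 0)) (\<lambda>_. 0) \<sigma> \<longleftrightarrow> sat w (\<lambda>_. 0) (\<lambda>_. 0) \<sigma>"
    using assms by (intro sat_permute[where M = M]) (auto simp: len M_def sentence_def)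
  \<comment> \<open>The default assignment in \<open>fm_lang\<close> maps everything to
    \<open>0\<close>, which \<open>\<pi>\<close> fixes.\<close>
  moreover have "\<pi> \<circ> (\<lambda>_ :: nat. 0) = (\<lambda>_. 0)" by (auto simp: \<pi>_def)
  ultimately have "w' \<in> fm_lang \<sigma> \<longleftrightarrow> w \<in> fm_lang \<sigma>" by (simp only: fm_lang_def mem_Collect_eq)
  moreover have "w \<in> fm_lang \<sigma>" by (auto simp: L w_def)
  ultimately obtain n where n: "w' = replicate n False @ replicate n True" by (auto simp: L)
  then have "n = M" using len arg_cong[OF n, of length] by simp
  then have "\<not> w' ! 0" using n M by (simp add: nth_append)
  moreover have "w' ! 0" using M by (simp add: w'_def w_def)
  ultimately show False by simp
qed

section \<open>The circuits\<close>

text \<open>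
  Node 0 is an AND of the negated inputs \<open>i\<close> with \<open>2 * i < n\<close> and of the majority gate 4, which says
  that at least half of the inputs are 1; its child 8, the constant true, makes up for the strict
  majority. Together they force \<open>n\<close> to be even, so parity needs no separate treatment. Node
  \<open>2 * i + 1\<close> is input \<open>i\<close>, and node \<open>4 * i + 2\<close> is its negation: in binary, least significant digit
  first, these names are \<open>1\<close> and \<open>01\<close> followed by the digits of \<open>i\<close>.
\<close>

definition zo_circuit :: "nat \<Rightarrow> circuit" where
  "zo_circuit n =
     \<lparr>nodes = {0, 4, 8} \<union> {2 * i + 1 | i. i < n} \<union> {4 * i + 2 | i. i < n},
      label = (\<lambda>a. if a = 0 then GAnd else if a = 4 then GMaj else if a = 8 then GConst True
                   else if odd a then GVar (a div 2) else GNot),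
      children = (\<lambda>a. if a = 0 then insert 4 {4 * i + 2 | i. 2 * i < n}
                      else if a = 4 then insert 8 {2 * i + 1 | i. i < n}
                      else if a = 8 \<or> odd a then {} else {a div 2})\<rparr>"

text \<open>A height function on node names. It yields acyclicity, the depth bound, and the number
  of rounds after which evaluation is stable.\<close>

definition rank :: "nat \<Rightarrow> nat" where
  "rank a = (if a = 0 then 2 else if a = 8 \<or> odd a then 0 else 1)"

lemma rank_decreases: "(a, b) \<in> edges (zo_circuit n) \<Longrightarrow> rank b < rank a"
  by (auto simp: edges_def zo_circuit_def rank_def split: if_splits)

lemma zo_depth: "depth_le (zo_circuit n) 2"
proof -
  have "rank b + k \<le> rank a" if "(a, b) \<in> edges (zo_circuit n) ^^ k" for a b k
    using that
  proof (induction k arbitrary: b)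
    case (Suc k)
    then obtain c where "(a, c) \<in> edges (zo_circuit n) ^^ k" "(c, b) \<in> edges (zo_circuit n)"
      by auto
    then show ?case using Suc.IH rank_decreases[of c b n] by fastforce
  qed auto
  moreover have "rank a \<le> 2" for a by (simp add: rank_def)
  ultimately have "k \<le> 2" if "(a, b) \<in> edges (zo_circuit n) ^^ k" for a b k
    using that by (meson add_leD2 order_trans)
  then show ?thesis unfolding depth_le_def by (metis ex_in_conv surj_pair)
qed

lemma zo_wf: "wf_circuit n (zo_circuit n)"
proof -
  let ?C = "zo_circuit n"
  have "children ?C a \<subseteq> nodes ?C \<and>
        (case label ?C a of
           GConst v \<Rightarrow> children ?C a = {}
         | GVar i \<Rightarrow> i < n \<and> children ?C a = {}
         | GNot \<Rightarrow> card (children ?C a) = 1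
         | _ \<Rightarrow> children ?C a \<noteq> {})" if "a \<in> nodes ?C" for a
  proof -
    from that consider "a \<in> {0, 4, 8}" | i where "i < n" "a = 2 * i + 1" | i where "i < n" "a = 4 * i + 2"
      unfolding zo_circuit_def by auto
    then show ?thesis
    proof cases
      case 1
      then show ?thesis by (auto simp: zo_circuit_def)
    next
      case 2
      then have "a \<noteq> 4" "a \<noteq> 8" by presburger+
      then show ?thesis using 2 by (simp add: zo_circuit_def)
    next
      case 3
      \<comment> \<open>Names of negations are 2 modulo 4, so they cannot collide with
        \<open>4\<close> or \<open>8\<close>.\<close>
      then have "a \<noteq> 4" "a \<noteq> 8" "a div 2 = 2 * i + 1" by presburger+
      then show ?thesis using 3 by (simp add: zo_circuit_def)
    qed
  qed
  moreover have "acyclic (edges ?C)" using rank_decreases by (rule acyclicI_order)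
  moreover have "finite (nodes ?C)" "0 \<in> nodes ?C" by (simp_all add: zo_circuit_def)
  ultimately show ?thesis unfolding wf_circuit_def by blast
qed

lemma zo_TC0_family: "TC0_family zo_circuit"
  unfolding TC0_family_def
proof (intro conjI exI allI)
  show "nodes (zo_circuit n) \<subseteq> {..<4 * n + 9}" for n by (auto simp: zo_circuit_def)
  show "(\<lambda>n. real (4 * n + 9)) \<in> O(\<lambda>n. real n ^ 1)" 
    \<comment> \<open>\<open>4 * n + 9 \<le> 13 * n\<close> as soon as
      \<open>n \<ge> 1\<close>.\<close>
    by (rule bigoI[of _ 13]) (auto intro!: eventually_sequentiallyI[of 1])
qed (fact zo_wf zo_depth)+

lemma gate_val_cong:
  assumes "\<And>b. b \<in> children C a \<Longrightarrow> val b = val' b"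
  shows "gate_val C w val a = gate_val C w val' a"
proof -
  have "{b \<in> children C a. val b} = {b \<in> children C a. val' b}" using assms by auto
  then show ?thesis using assms by (auto simp: gate_val_def split: gate.split)
qed

text \<open>The first condition confines the ones to the last \<open>length w div 2\<close>
  positions. To make up half of the word they must fill all of these, and the length must be
  even.\<close>

lemma half_zeros_half_ones:
  "(\<forall>i. 2 * i < length w \<longrightarrow> \<not> w ! i) \<and> 2 * card {i. i < length w \<and> w ! i} \<ge> length w \<longleftrightarrow>
   (\<exists>n. w = replicate n False @ replicate n True)"
proof safe
  fix n
  let ?w = "replicate n False @ replicate n True"
  show "?w ! i \<Longrightarrow> 2 * i < length ?w \<Longrightarrow> False" for i by (simp add: nth_append)
  have "{i. i < length ?w \<and> ?w ! i} = {n..<2 * n}" by (auto simp: nth_append)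
  then show "length ?w \<le> 2 * card {i. i < length ?w \<and> ?w ! i}" by simp
next
  assume zeros: "\<forall>i. 2 * i < length w \<longrightarrow> \<not> w ! i"
    and ones: "2 * card {i. i < length w \<and> w ! i} \<ge> length w"
  define I where "I = {i. i < length w \<and> w ! i}"
  have sub: "I \<subseteq> {length w - length w div 2..<length w}"
  proof
    fix i assume "i \<in> I"
    then have "i < length w" "\<not> 2 * i < length w" using zeros by (auto simp: I_def)
    then show "i \<in> {length w - length w div 2..<length w}" by (simp; presburger)
  qed
  then have le: "card I \<le> length w div 2" using card_mono[OF _ sub] by simp
  define m where "m = length w div 2"
  have m: "length w = 2 * m" using le ones unfolding m_def I_def by linarith
  have "I \<subseteq> {m..<2 * m}" using sub unfolding m by simp
  moreover have "card I = m" using le ones[folded I_def] unfolding m by simp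
  ultimately have I: "I = {m..<2 * m}" by (intro card_subset_eq) auto
  have "w = replicate m False @ replicate m True"
  proof (rule nth_equalityI)
    fix i assume "i < length w"
    moreover from this have "w ! i \<longleftrightarrow> i \<ge> m" using I m unfolding I_def set_eq_iff by auto
    ultimately show "w ! i = (replicate m False @ replicate m True) ! i"
      using m by (auto simp: nth_append)
  qed (use m in simp)
  then show "\<exists>n. w = replicate n False @ replicate n True" by blast
qed

lemma zo_language: "family_lang zo_circuit = {replicate n False @ replicate n True | n. n \<ge> 0}"
proof -
  have "circuit_accepts (zo_circuit (length w)) w \<longleftrightarrow>
      (\<exists>n. w = replicate n False @ replicate n True)" for w
  proof -
    let ?n = "length w"
    let ?C = "zo_circuit ?n"
    have acc: "circuit_accepts ?C w \<longleftrightarrow>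
        (\<forall>i. 2 * i < ?n \<longrightarrow> \<not> w ! i) \<and> 2 * card {i. i < ?n \<and> w ! i} \<ge> ?n"
    proof -
      define V where "V val \<longleftrightarrow> (\<forall>a \<in> nodes ?C. val a = gate_val ?C w val a)" for val
      \<comment> \<open>Every consistent valuation has the same output; that one exists is shown
        afterwards.\<close>
      have val: "val 0 \<longleftrightarrow> (\<forall>i. 2 * i < ?n \<longrightarrow> \<not> w ! i) \<and> 2 * card {i. i < ?n \<and> w ! i} \<ge> ?n"
        if "V val" for val
      proof -
        have g: "val a = gate_val ?C w val a" if "a \<in> nodes ?C" for a
          using \<open>V val\<close> that unfolding V_def by blast
        have var: "val (2 * i + 1) = w ! i" if "i < ?n" for i
        proof -
          have "2 * i + 1 \<noteq> 4" "2 * i + 1 \<noteq> 8" by presburger+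
          then show ?thesis using that by (subst g) (auto simp: gate_val_def zo_circuit_def)
        qed
        have "val (4 * i + 2) = (\<not> w ! i)" if "i < ?n" for i
        proof -
          have "4 * i + 2 \<noteq> 4" "4 * i + 2 \<noteq> 8" "(4 * i + 2) div 2 = 2 * i + 1" by presburger+
          then show ?thesis using that var[of i]
            by (subst g) (auto simp: gate_val_def zo_circuit_def)
        qed
        moreover have v8: "val 8" by (subst g) (auto simp: gate_val_def zo_circuit_def)
        moreover have "val 4 \<longleftrightarrow> 2 * card {i. i < ?n \<and> w ! i} \<ge> ?n"
        proof -
          have ch: "children ?C 4 = insert 8 ((\<lambda>i. 2 * i + 1) ` {i. i < ?n})"
            by (auto simp: zo_circuit_def)
          have 8: "8 \<notin> (\<lambda>i. 2 * i + 1) ` A" for A :: "nat set" by (auto; presburger)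
          have "card (children ?C 4) = ?n + 1"
            unfolding ch using 8 by (subst card_insert_disjoint) (auto simp: card_image inj_on_def)
          moreover have "{b \<in> children ?C 4. val b} =
              insert 8 ((\<lambda>i. 2 * i + 1) ` {i. i < ?n \<and> w ! i})"
            unfolding ch using v8 var by auto
          then have "card {b \<in> children ?C 4. val b} = card {i. i < ?n \<and> w ! i} + 1"
            using 8 by (simp add: card_insert_disjoint card_image inj_on_def)
          \<comment> \<open>With \<open>c\<close> ones among \<open>n\<close> inputs, the extra true
            child gives \<open>2 * (c + 1) > n + 1\<close>, that is,
            \<open>2 * c \<ge> n\<close>.\<close>
          moreover have "val 4 \<longleftrightarrow> 2 * card {b \<in> children ?C 4. val b} > card (children ?C 4)"
            by (subst g) (auto simp: gate_val_def zo_circuit_def)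
          ultimately show ?thesis by auto
        qed
        moreover have "val 0 \<longleftrightarrow> val 4 \<and> (\<forall>i. 2 * i < ?n \<longrightarrow> val (4 * i + 2))"
          by (subst g) (auto simp: gate_val_def zo_circuit_def)
        ultimately show ?thesis by auto
      qed
      \<comment> \<open>A consistent valuation arises by simultaneous re-evaluation of all gates:
        after \<open>k\<close> rounds the nodes of rank below \<open>k\<close> are stable, so three
        rounds suffice.\<close>
      define W where "W k = (gate_val ?C w ^^ k) (\<lambda>_. False)" for k
      have W: "gate_val ?C w (W k) a = W k a" if "a \<in> nodes ?C" "rank a < k" for a k
        using that
      proof (induction k arbitrary: a)
        case (Suc k)
        have "gate_val ?C w (W (Suc k)) a = gate_val ?C w (W k) a"
        proof (rule gate_val_cong)
          fix b assume "b \<in> children ?C a"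
          then have "b \<in> nodes ?C" "rank b < k"
            using Suc.prems zo_wf[of ?n] rank_decreases[of a b ?n]
            by (auto simp: wf_circuit_def edges_def)
          then show "W (Suc k) b = W k b" using Suc.IH by (simp add: W_def)
        qed
        then show ?case by (simp add: W_def)
      qed simp
      have "rank a < 3" for a by (simp add: rank_def)
      then have "V (W 3)" unfolding V_def using W by metis
      moreover have "circuit_accepts ?C w \<longleftrightarrow> (\<exists>val. V val \<and> val 0)"
        by (simp only: circuit_accepts_def V_def)
      ultimately show ?thesis using val by blast
    qed
    also have "\<dots> \<longleftrightarrow> (\<exists>n. w = replicate n False @ replicate n True)"
      by (rule half_zeros_half_ones)
    finally show ?thesis .
  qed
  then show ?thesis by (auto simp: family_lang_def)
qed

section \<open>A machine for the direct connection language\<close>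

text \<open>
  An encoded connection starts with one of the finitely many words in \<open>accs\<close> (connections that
  exist for every input length) or \<open>heads\<close>; after a word of the latter come the digits of some \<open>i\<close>,
  a separator, and what is prescribed by the \<open>goal\<close>: the input string \<open>y\<close>, with a bound on
  \<open>i\<close> or \<open>2 * i\<close> in terms of \<open>|y|\<close>, or a second copy of \<open>i\<close> first.
\<close>

datatype goal = SkipBit | Compare | Add bool

text \<open>\<open>Scan\<close> remembers the prefix read, \<open>Copy\<close> the last digit copied
  (initially \<open>True\<close>), so that redundant zeros are detected, and \<open>Sum\<close> the
  carry. \<open>Carry q\<close> and \<open>Back q\<close> belong to an increment of the counter that
  resumes in \<open>q\<close>.\<close>

datatype st = Init | Probe | Erase | Scan "isym list" | Copy goal bool | Rewind goal | Goal goal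
  | Sum bool | Check | Carry st | Back st | Acc | Rej

text \<open>The prefixes of \<open>encode 3 0 4 y\<close>, \<open>encode 5 4 8 y\<close> and
  \<open>encode 0 8 1 y\<close> before \<open>y\<close>.\<close>

definition accs :: "isym list set" where
  "accs = {[Bit True, Bit True, Sep, Sep, Bit False, Bit False, Bit True, Sep],
           [Bit True, Bit False, Bit True, Sep, Bit False, Bit False, Bit True, Sep,
            Bit False, Bit False, Bit False, Bit True, Sep],
           [Sep, Bit False, Bit False, Bit False, Bit True, Sep, Bit True, Sep]}"

text \<open>In this order: AND to negation \<open>4 * i + 2\<close>, majority to input
  \<open>2 * i + 1\<close>, negation \<open>4 * i + 2\<close> to its input, and input
  \<open>2 * i + 1\<close> with its index. In the third, the second copy of \<open>i\<close> follows
  one more digit 1, which \<open>SkipBit\<close> consumes; the flag of \<open>Add\<close> asks for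
  doubling.\<close>

definition heads :: "isym list \<Rightarrow> goal option" where
  "heads = [[Bit True, Bit True, Sep, Sep, Bit False, Bit True] \<mapsto> Add True,
            [Bit True, Bit False, Bit True, Sep, Bit False, Bit False, Bit True, Sep, Bit True]
              \<mapsto> Add False,
            [Bit False, Bit True, Sep, Bit False, Bit True] \<mapsto> SkipBit,
            [Bit True, Sep, Bit True] \<mapsto> Compare]"

text \<open>Starts an increment of the counter from cell 0; without a carry it is finished in this
  single step.\<close>

definition advance :: "st \<Rightarrow> nat \<Rightarrow> nat \<times> move \<Rightarrow> st \<times> (nat \<times> move) \<times> (nat \<times> move)" where
  "advance q s x = (if s = 1 then (Carry q, (2, Right), x) else (q, (1, Stay), x))"

definition digit :: "bool \<Rightarrow> nat" where
  "digit b = (if b then 4 else 3)"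

definition reject :: "nat \<Rightarrow> nat \<Rightarrow> st \<times> (nat \<times> move) \<times> (nat \<times> move)" where
  "reject s r = (Rej, (s, Stay), (r, Stay))"

text \<open>
  Tape 0 is a binary counter running through the addresses. In its cell 0 the digit 0 is written as
  the symbol 2, so that the head finds its way back after a carry. On tape 1, cell 0 carries the
  symbol 1 and the following cells a ruler of symbols 2, roughly as many as the input length has
  digits. The digits of \<open>i\<close> are stored over the ruler, as 3 and 4; longer numbers are rejected, since
  they exceed the input length anyway. At the end \<open>i\<close> or \<open>2 * i\<close> is added to the counter, which
  then holds the address where \<open>y\<close> begins, and the machine tests whether the sum is still a valid
  address.
\<close>

fun delta :: "st \<Rightarrow> isym option \<Rightarrow> nat \<Rightarrow> nat \<Rightarrow> st \<times> (nat \<times> move) \<times> (nat \<times> move)" where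
  "delta Init x s r = (Probe, (2, Right), (1, Right))"
| "delta Probe x s r =
     (if x = None then (Erase, (0, Left), (2, Left)) else (Probe, (1, Right), (2, Right)))"
| "delta Erase x s r =
     (if s = 2 then (Scan [], (2, Stay), (r, Right)) else (Erase, (0, Left), (r, Left)))"
| "delta (Scan us) x s r =
     (case x of
        None \<Rightarrow> reject s r
      | Some y \<Rightarrow>
          if us @ [y] \<in> accs then (Acc, (s, Stay), (r, Stay))
          else case heads (us @ [y]) of
            Some g \<Rightarrow> advance (Copy g True) s (r, Stay)
          | None \<Rightarrow>
              if \<exists>vs. us @ [y] @ vs \<in> accs \<union> dom heads then advance (Scan (us @ [y])) s (r, Stay)
              else reject s r)"
| "delta (Copy g b) x s r =
     (case x of
        Some (Bit c) \<Rightarrow> if r = 2 then advance (Copy g c) s (digit c, Right) else reject s r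
      | Some Sep \<Rightarrow> if b then advance (Rewind g) s (r, Stay) else reject s r
      | None \<Rightarrow> reject s r)"
| "delta (Rewind g) x s r =
     (if r = 1 then (Goal g, (s, Stay), (r, Right)) else (Rewind g, (s, Stay), (r, Left)))"
| "delta (Goal SkipBit) x s r =
     (if x = Some (Bit True) then advance (Goal Compare) s (r, Stay) else reject s r)"
| "delta (Goal Compare) x s r =
     (case x of
        Some (Bit c) \<Rightarrow> if r = digit c then advance (Goal Compare) s (r, Right) else reject s r
      | Some Sep \<Rightarrow>
          if r \<in> range digit then reject s r else advance (Rewind (Add False)) s (r, Stay)
      | None \<Rightarrow> reject s r)"
| "delta (Goal (Add d)) x s r = (Sum False, (s, if d then Right else Stay), (r, Stay))"
| "delta (Sum c) x s r =
     (if r \<in> range digit then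
        (Sum (of_bool (s = 1) + of_bool (r = digit True) + of_bool c \<ge> (2 :: nat)),
         ((of_bool (s = 1) + of_bool (r = digit True) + of_bool c) mod 2, Right), (r, Right))
      else if c \<and> s = 1 then (Sum True, (0, Right), (r, Stay))
      else (Check, (if c then 1 else s, Stay), (r, Stay)))"
| "delta Check x s r = (if x = None then reject s r else (Acc, (s, Stay), (r, Stay)))"
| "delta (Carry q) x s r =
     (if s = 1 then (Carry q, (0, Right), (r, Stay)) else (Back q, (1, Left), (r, Stay)))"
| "delta (Back q) x s r =
     (if s = 2 then (q, (s, Stay), (r, Stay)) else (Back q, (s, Left), (r, Stay)))"
| "delta Acc x s r = (Acc, (s, Stay), (r, Stay))"
| "delta Rej x s r = reject s r"

text \<open>The type \<open>st\<close> is infinite. Finitely many states suffice because increments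
  are not nested and scanned prefixes are no longer than the longest pattern, which has 13
  symbols.\<close>

fun base_state :: "st \<Rightarrow> bool" where
  "base_state (Scan us) \<longleftrightarrow> length us \<le> 13"
| "base_state (Carry q) \<longleftrightarrow> False"
| "base_state (Back q) \<longleftrightarrow> False"
| "base_state q \<longleftrightarrow> True"

fun valid_state :: "st \<Rightarrow> bool" where
  "valid_state (Carry q) \<longleftrightarrow> base_state q"
| "valid_state (Back q) \<longleftrightarrow> base_state q"
| "valid_state q \<longleftrightarrow> base_state q"

lemma finite_UNIV_goal: "finite (UNIV :: goal set)"
proof -
  have "g \<in> {SkipBit, Compare, Add True, Add False}" for g
  proof (cases g)
    case (Add d)
    then show ?thesis by (cases d) simp_all
  qed simp_all
  then have "UNIV \<subseteq> {SkipBit, Compare, Add True, Add False}" by blast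
  then show ?thesis by (rule finite_subset) simp
qed

lemma finite_UNIV_isym: "finite (UNIV :: isym set)"
proof -
  have "x \<in> {Bit True, Bit False, Sep}" for x
  proof (cases x)
    case (Bit b)
    then show ?thesis by (cases b) simp_all
  qed simp
  then have "UNIV \<subseteq> {Bit True, Bit False, Sep}" by blast
  then show ?thesis by (rule finite_subset) simp
qed

lemma finite_valid_states: "finite {q. valid_state q}"
proof -
  note [simp] = finite_UNIV_goal finite_UNIV_isym
  define B where "B = {Init, Probe, Erase, Check, Acc, Rej} \<union> range Sum \<union> range Goal \<union> range Rewind
     \<union> (\<lambda>(g, b). Copy g b) ` (UNIV \<times> UNIV) \<union> Scan ` {us. length us \<le> 13}"
  have "finite {us :: isym list. length us \<le> 13}"
    using finite_lists_length_le[of "UNIV :: isym set" 13] by simp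
  then have "finite B" unfolding B_def
    by (intro finite_UnI finite_imageI finite_cartesian_product) simp_all
  then have "finite (B \<union> Carry ` B \<union> Back ` B)" by simp
  moreover have base: "q \<in> B" if "base_state q" for q
    using that by (cases q) (auto simp: B_def)
  then have "{q. valid_state q} \<subseteq> B \<union> Carry ` B \<union> Back ` B"
    by (auto elim!: valid_state.elims)
  ultimately show ?thesis by (rule finite_subset[rotated])
qed

lemma dom_heads:
  "dom heads = {[Bit True, Bit True, Sep, Sep, Bit False, Bit True],
     [Bit True, Bit False, Bit True, Sep, Bit False, Bit False, Bit True, Sep, Bit True],
     [Bit False, Bit True, Sep, Bit False, Bit True], [Bit True, Sep, Bit True]}"
  by (simp only: heads_def dom_fun_upd dom_empty option.distinct if_False) blast

lemma length_pattern: "us \<in> accs \<union> dom heads \<Longrightarrow> length us \<le> 13"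
  unfolding accs_def dom_heads by (elim UnE insertE emptyE) simp_all

text \<open>Hence an input begins with at most one pattern, and the scan may commit itself to the
  first match.\<close>

lemma prefix_free:
  assumes "us \<in> accs \<union> dom heads" "us @ vs \<in> accs \<union> dom heads"
  shows "vs = []"
  using assms unfolding accs_def dom_heads by (elim UnE insertE emptyE) simp_all

lemma delta_valid_state: "valid_state q \<Longrightarrow> valid_state (fst (delta q x s r))"
proof -
  have step: "valid_state (fst (advance q s y))" if "base_state q" for q s y
    using that by (cases q) (auto simp: advance_def)
  have rej: "valid_state (fst (reject s r))" by (simp add: reject_def)
  assume q: "valid_state q"
  show ?thesis
  proof (cases q)
    case (Scan us)
    have "valid_state (fst (delta (Scan us) (Some y) s r))" for y
    proof (cases "\<exists>vs. us @ [y] @ vs \<in> accs \<union> dom heads")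
      case True
      then obtain vs where "us @ [y] @ vs \<in> accs \<union> dom heads" by blast
      then have "length (us @ [y]) \<le> 13" using length_pattern[of "us @ [y] @ vs"] by simp
      then have "valid_state (fst (advance (Scan (us @ [y])) s (r, Stay)))" by (intro step) simp
      then show ?thesis using rej step by (simp split: option.split)
    next
      case False
      then show ?thesis using rej step by (simp split: option.split)
    qed
    then show ?thesis using Scan rej by (cases x) simp_all
  next
    case (Goal g)
    then show ?thesis using rej step by (cases g) (simp_all split: option.split isym.split)
  next
    case (Back p)
    then show ?thesis using q by (cases p) auto
  qed (use q rej step in \<open>simp_all split: option.split isym.split\<close>)
qed

lemma delta_symbols:
  assumes "s < 5" "r < 5"
  shows "case delta q x s r of (q', (s', m), (r', m')) \<Rightarrow> s' < 5 \<and> r' < 5"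
proof -
  note delta_symbol_simps = advance_def reject_def digit_def
  show ?thesis
  proof (cases q)
    case (Goal g)
    then show ?thesis using assms
      by (cases g) (simp_all add: delta_symbol_simps split: option.split isym.split)
  next
    case (Sum c)
    have "n mod 2 < 5" for n :: nat by (rule less_trans[of _ 2]) simp_all
    then show ?thesis using assms Sum by simp
  qed (use assms in \<open>simp_all add: delta_symbol_simps split: option.split isym.split\<close>)
qed

section \<open>Correctness and running time of the machine\<close>

definition addr :: "(nat \<Rightarrow> nat) \<Rightarrow> nat" where
  "addr f = (\<Sum>j | f j = 1. 2 ^ j)"

definition input_at :: "isym list \<Rightarrow> nat \<Rightarrow> isym option" where
  "input_at w i = (if i < length w then Some (w ! i) else None)"

text \<open>Correctness is proved for symbolic states and an explicit pair of tapes; the coding as a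
  \<open>tm\<close> comes at the end.\<close>

fun step :: "isym list \<Rightarrow> st \<times> tape \<times> tape \<Rightarrow> st \<times> tape \<times> tape" where
  "step w (q, (f, h), (g, k)) =
     (let (q', y, z) = delta q (input_at w (addr f)) (f h) (g k)
      in (q', tape_act y (f, h), tape_act z (g, k)))"

definition halts :: "isym list \<Rightarrow> st \<times> tape \<times> tape \<Rightarrow> nat \<Rightarrow> bool \<Rightarrow> bool" where
  "halts w c t v \<longleftrightarrow> (\<exists>k \<le> t. fst ((step w ^^ k) c) = (if v then Acc else Rej))"

lemma halts_step:
  assumes "halts w c' t v" "t < t'" "step w c = c'"
  shows "halts w c t' v"
proof -
  obtain k where "k \<le> t" "fst ((step w ^^ k) c') = (if v then Acc else Rej)"
    using assms(1) unfolding halts_def by blast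
  then show ?thesis unfolding halts_def using assms(2,3)
    by (intro exI[of _ "Suc k"]) (simp add: funpow_Suc_right del: funpow.simps)
qed

lemma halts_Acc: "halts w (Acc, T) t True"
  unfolding halts_def by (intro exI[of _ 0]) simp

lemma halts_Rej: "halts w (Rej, T) t False"
  unfolding halts_def by (intro exI[of _ 0]) simp

section \<open>The address counter and the amortised cost of incrementing it\<close>

definition ones :: "(nat \<Rightarrow> nat) \<Rightarrow> nat" where
  "ones f = card {j. f j = 1}"

text \<open>Stated additively to avoid subtraction on naturals. Weights \<open>2 ^ j\<close> give
  the value of the counter, weights \<open>1\<close> its number of ones.\<close>

lemma sum_ones_upd:
  fixes c :: "nat \<Rightarrow> nat"
  assumes "finite {j. f j = (1 :: nat)}"
  shows "(\<Sum>j | (f(h := x)) j = 1. c j) + (if f h = 1 then c h else 0) =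
         (\<Sum>j | f j = 1. c j) + (if x = 1 then c h else 0)"
proof -
  let ?S = "{j. f j = 1}"
  have "{j. (f(h := x)) j = 1} = (if x = 1 then insert h ?S else ?S - {h})" by auto
  moreover have "sum c ?S = c h + sum c (?S - {h})" if "h \<in> ?S"
    using assms that by (rule sum.remove)
  moreover have "sum c (insert h ?S) = (if h \<in> ?S then sum c ?S else c h + sum c ?S)"
    using assms by (simp add: insert_absorb)
  moreover have "?S - {h} = ?S" if "h \<notin> ?S" using that by simp
  ultimately show ?thesis by (cases "x = 1"; cases "h \<in> ?S") simp_all
qed

lemma addr_upd:
  assumes "finite {j. f j = (1 :: nat)}"
  shows "addr (f(h := x)) + (if f h = 1 then 2 ^ h else 0) = addr f + (if x = 1 then 2 ^ h else 0)"
  using sum_ones_upd[OF assms, where c = "\<lambda>j. 2 ^ j"] unfolding addr_def by blast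

lemma ones_upd:
  assumes "finite {j. f j = (1 :: nat)}"
  shows "ones (f(h := x)) + (if f h = 1 then 1 else 0) = ones f + (if x = 1 then 1 else 0)"
  using sum_ones_upd[OF assms, where c = "\<lambda>_. 1"] unfolding ones_def card_eq_sum by blast

lemma finite_ones_upd:
  assumes "finite {j. f j = (1 :: nat)}"
  shows "finite {j. (f(h := x)) j = 1}"
  by (rule finite_subset[of _ "insert h {j. f j = 1}"]) (use assms in auto)

definition counter :: "(nat \<Rightarrow> nat) \<Rightarrow> nat \<Rightarrow> bool" where
  "counter f v \<longleftrightarrow> f 0 \<in> {1, 2} \<and> (\<forall>j > 0. f j \<le> 1) \<and> finite {j. f j = 1} \<and> addr f = v"

text \<open>
  Amortised time: the potential \<open>2 * ones f\<close> pays for the carries of the counter \<open>f\<close>.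
\<close>

definition runs :: "isym list \<Rightarrow> st \<Rightarrow> tape \<Rightarrow> nat \<Rightarrow> nat \<Rightarrow> bool \<Rightarrow> bool" where
  "runs w q T v t V \<longleftrightarrow> (\<forall>f. counter f v \<longrightarrow> halts w (q, (f, 0), T) (t + 2 * ones f) V)"

text \<open>After a carry, cell 0 holds the symbol 2 and the cells passed on the way back are 0, so
  the first 2 met marks cell 0.\<close>

lemma back_halts:
  assumes "runs w q T v t V" "counter f v" "f 0 = 2" "\<And>j. 0 < j \<Longrightarrow> j \<le> h \<Longrightarrow> f j = 0"
  shows "halts w (Back q, (f, h), T) (t + 2 * ones f + h + 1) V"
  using assms(4)
proof (induction h)
  obtain g k where T: "T = (g, k)" by (cases T)
  case 0
  show ?case
    by (rule halts_step[of _ "(q, (f, 0), T)" "t + 2 * ones f"])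
      (use assms(1-3) in \<open>auto simp: runs_def T fun_upd_idem_iff\<close>)
next
  obtain g k where T: "T = (g, k)" by (cases T)
  case (Suc h)
  have "halts w (Back q, (f, h), T) (t + 2 * ones f + h + 1) V" by (rule Suc.IH) (use Suc.prems in auto)
  then show ?case
    by (rule halts_step) (use Suc.prems[of "Suc h"] in \<open>auto simp: T fun_upd_idem_iff\<close>)
qed

text \<open>The pending carry is worth \<open>2 ^ h\<close>. Passing it on erases a one and so frees
  two units of potential: one pays for this step, the other for the longer way back.\<close>

lemma carry_halts:
  assumes "runs w q T v t V"
    and "f 0 = 2" "0 < h" "\<And>j. 0 < j \<Longrightarrow> j < h \<Longrightarrow> f j = 0" "\<And>j. h \<le> j \<Longrightarrow> f j \<le> 1"
      "finite {j. f j = 1}" "addr f + 2 ^ h = v"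
  shows "halts w (Carry q, (f, h), T) (t + 2 * ones f + h + 4) V"
  using assms(2-)
proof (induction "ones f" arbitrary: f h rule: less_induct)
  case less
  obtain g k where T: "T = (g, k)" by (cases T)
  show ?case
  proof (cases "f h = 1")
    case True
    let ?f = "f(h := 0)"
    have o: "ones ?f + 1 = ones f" using ones_upd[OF less.prems(5), of h 0] True by simp
    have "addr ?f + 2 ^ h = addr f" using addr_upd[OF less.prems(5), of h 0] True by simp
    then have a: "addr ?f + 2 ^ Suc h = v" using less.prems(6) by simp
    have "halts w (Carry q, (?f, Suc h), T) (t + 2 * ones ?f + Suc h + 4) V"
    proof (rule less.hyps)
      fix j assume "0 < j" "j < Suc h"
      then show "?f j = 0" using less.prems(3)[of j] by (cases "j = h") auto
    next
      fix j assume "Suc h \<le> j"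
      then show "?f j \<le> 1" using less.prems(4)[of j] by auto
    qed (use o a less.prems(1,2) finite_ones_upd[OF less.prems(5)] in simp_all)
    then show ?thesis
      by (rule halts_step) (use o True in \<open>simp_all add: T\<close>)
  next
    case False
    then have f0: "f h = 0" using less.prems(4)[of h] by simp
    let ?f = "f(h := 1)"
    have o: "ones ?f = ones f + 1" using ones_upd[OF less.prems(5), of h 1] False by simp
    have "addr ?f = v" using addr_upd[OF less.prems(5), of h 1] False less.prems(6) by simp
    moreover have "?f j \<le> 1" if "j > 0" for j
      using less.prems(3)[OF that] less.prems(4)[of j] by (cases "j < h") auto
    ultimately have "counter ?f v"
      unfolding counter_def using finite_ones_upd[OF less.prems(5), of h 1] less.prems(1,2) by simp
    then have "halts w (Back q, (?f, h - 1), T) (t + 2 * ones ?f + (h - 1) + 1) V"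
      using less.prems by (intro back_halts[OF assms(1)]) auto
    then show ?thesis
      by (rule halts_step) (use o False less.prems(2) in \<open>simp_all add: T\<close>)
  qed
qed

text \<open>An increment has amortised cost at most 6, however far the carry travels.\<close>

lemma runs_advance:
  assumes "\<And>s. delta q (input_at w v) s (g k) = advance q' s y"
    and runs: "runs w q' (tape_act y (g, k)) (Suc v) t V" and "t + 6 \<le> t'"
  shows "runs w q (g, k) v t' V"
  unfolding runs_def
proof (intro allI impI)
  fix f assume "counter f v"
  then have f: "f 0 = 1 \<or> f 0 = 2" "\<And>j. j > 0 \<Longrightarrow> f j \<le> 1" "finite {j. f j = 1}" "addr f = v"
    by (auto simp: counter_def)
  let ?T = "tape_act y (g, k)"
  from f(1) show "halts w (q, (f, 0), (g, k)) (t' + 2 * ones f) V"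
  proof
    assume f0: "f 0 = 1"
    let ?f = "f(0 := 2)"
    have o: "ones ?f + 1 = ones f" using ones_upd[OF f(3), of 0 2] f0 by simp
    have a: "addr ?f + 2 ^ 1 = Suc v" using addr_upd[OF f(3), of 0 2] f0 f(4) by simp
    have "halts w (Carry q', (?f, 1), ?T) (t + 2 * ones ?f + 1 + 4) V"
      using f(2) by (intro carry_halts[OF runs _ _ _ _ _ a] finite_ones_upd[OF f(3)]) auto
    then show ?thesis
      by (rule halts_step) (use o f0 f(4) assms(1,3) in \<open>simp_all add: advance_def\<close>)
  next
    assume f0: "f 0 = 2"
    let ?f = "f(0 := 1)"
    have o: "ones ?f = ones f + 1" using ones_upd[OF f(3), of 0 1] f0 by simp
    have "addr ?f = Suc v" using addr_upd[OF f(3), of 0 1] f0 f(4) by simp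
    then have "counter ?f (Suc v)"
      unfolding counter_def using f(2) finite_ones_upd[OF f(3), of 0 1] by simp
    then have "halts w (q', (?f, 0), ?T) (t + 2 * ones ?f) V" using runs unfolding runs_def by blast
    then show ?thesis
      by (rule halts_step) (use o f0 f(4) assms(1,3) in \<open>simp_all add: advance_def\<close>)
  qed
qed

lemma runs_reject:
  assumes "\<And>s. delta q (input_at w v) s (g k) = reject s (g k)" "0 < t"
  shows "runs w q (g, k) v t False"
  unfolding runs_def
proof (intro allI impI)
  fix f assume "counter f v"
  then have "addr f = v" by (simp add: counter_def)
  then show "halts w (q, (f, 0), (g, k)) (t + 2 * ones f) False"
    using assms by (intro halts_step[OF halts_Rej[of w "((f, 0), (g, k))" 0]])
      (simp_all add: reject_def)
qed

definition store :: "nat \<Rightarrow> bool list \<Rightarrow> nat \<Rightarrow> nat" where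
  "store l us j = (if j = 0 then 1 else if j \<le> length us then digit (us ! (j - 1))
                   else if j \<le> l then 2 else 0)"

lemma digit_eq_iff: "digit b = digit c \<longleftrightarrow> b = c"
  by (simp add: digit_def)

lemma store_digit: "k < length us \<Longrightarrow> store l us (Suc k) = digit (us ! k)"
  by (simp add: store_def)

lemma store_beyond: "length us \<le> k \<Longrightarrow> store l us (Suc k) = (if k < l then 2 else 0)"
  by (simp add: store_def)

lemma store_append:
  "length us < l \<Longrightarrow> (store l us)(Suc (length us) := digit c) = store l (us @ [c])"
  by (rule ext) (auto simp: store_def nth_append)

lemma store_eq_1: "store l us k = 1 \<longleftrightarrow> k = 0"
  by (simp add: store_def digit_def)

lemma runs_rewind:
  assumes "runs w (Goal g) (store l us, 1) v t V" "t + k + 1 \<le> t'"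
  shows "runs w (Rewind g) (store l us, k) v t' V"
  using assms(2)
proof (induction k arbitrary: t')
  case 0
  show ?case unfolding runs_def
  proof (intro allI impI)
    fix f assume "counter f v"
    then have "halts w (Goal g, (f, 0), (store l us, 1)) (t + 2 * ones f) V"
      using assms(1) by (simp add: runs_def)
    then show "halts w (Rewind g, (f, 0), (store l us, 0)) (t' + 2 * ones f) V"
      by (rule halts_step) (use 0 in \<open>simp_all add: store_eq_1 fun_upd_idem_iff del: One_nat_def\<close>)
  qed
next
  case (Suc k)
  show ?case unfolding runs_def
  proof (intro allI impI)
    fix f assume f: "counter f v"
    have "runs w (Rewind g) (store l us, k) v (t + k + 1) V" by (rule Suc.IH) simp
    then have "halts w (Rewind g, (f, 0), (store l us, k)) (t + k + 1 + 2 * ones f) V"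
      using f by (simp add: runs_def)
    then show "halts w (Rewind g, (f, 0), (store l us, Suc k)) (t' + 2 * ones f) V"
      by (rule halts_step) (use Suc.prems in \<open>simp_all add: store_eq_1 del: One_nat_def\<close>)
  qed
qed

section \<open>Adding the stored number to the counter\<close>

fun val :: "bool list \<Rightarrow> nat" where
  "val [] = 0"
| "val (b # us) = of_bool b + 2 * val us"

lemma check_halts:
  assumes "addr f = s" "2 \<le> t"
  shows "halts w (Check, (f, h), T) t (s < length w)"
proof -
  obtain g k where T: "T = (g, k)" by (cases T)
  show ?thesis
  proof (cases "s < length w")
    case True
    show ?thesis
      by (rule halts_step[of _ "(Acc, (f, h), T)" 0])
        (use True assms in \<open>simp_all add: T input_at_def halts_Acc\<close>)
  next
    case False
    show ?thesis
      by (rule halts_step[of _ "(Rej, (f, h), T)" 0])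
        (use False assms in \<open>simp_all add: T input_at_def reject_def halts_Rej\<close>)
  qed
qed

text \<open>Once the stored digits are exhausted, the carry may still ripple through ones of the
  counter; each ripple erases one of them, which bounds the time by the potential.\<close>

lemma sum_halts_beyond:
  assumes "length us \<le> k"
  shows "finite {j. f j = 1} \<Longrightarrow> addr f + 2 ^ h * of_bool c = s \<Longrightarrow>
    halts w (Sum c, (f, h), (store l us, Suc k)) (2 * ones f + 3) (s < length w)"
proof (induction "ones f" arbitrary: f h c rule: less_induct)
  case less
  have r: "store l us (Suc k) \<notin> range digit"
    using assms by (auto simp: store_beyond digit_def)
  show ?case
  proof (cases "c \<and> f h = 1")
    case True
    let ?f = "f(h := 0)"
    have o: "ones ?f + 1 = ones f" using ones_upd[OF less.prems(1), of h 0] True by simp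
    have "addr ?f + 2 ^ Suc h * of_bool True = s"
      using addr_upd[OF less.prems(1), of h 0] True less.prems(2) by simp
    then have "halts w (Sum True, (?f, Suc h), (store l us, Suc k)) (2 * ones ?f + 3) (s < length w)"
      using o finite_ones_upd[OF less.prems(1)] by (intro less.hyps) simp_all
    then show ?thesis
      by (rule halts_step) (use o True r in simp_all)
  next
    case False
    let ?f = "f(h := if c then 1 else f h)"
    have "addr ?f = s"
    proof (cases c)
      case True
      then show ?thesis using False addr_upd[OF less.prems(1), of h 1] less.prems(2) by simp
    qed (use less.prems(2) in simp)
    then have "halts w (Check, (?f, h), (store l us, Suc k)) 2 (s < length w)"
      by (rule check_halts) simp
    then show ?thesis
      by (rule halts_step) (use False r in simp_all)
  qed
qed

text \<open>Schoolbook addition: the counter, plus the carry and the remaining digits weighted by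
  \<open>2 ^ h\<close>, stays equal to the final sum \<open>s\<close>. The marker 2 in cell 0 may be
  overwritten, since the head does not return. A digit costs 3: one step, and two units of potential
  for a possible new one.\<close>

lemma sum_halts:
  "finite {j. f j = 1} \<Longrightarrow> addr f + 2 ^ h * (of_bool c + val (drop k us)) = s \<Longrightarrow>
    halts w (Sum c, (f, h), (store l us, Suc k)) (2 * ones f + 3 * (length us - k) + 3) (s < length w)"
proof (induction "length us - k" arbitrary: f h c k)
  case 0
  then show ?case using sum_halts_beyond[of us k f h c s w l] by simp
next
  case (Suc n)
  then have k: "k < length us" by simp
  \<comment> \<open>A full adder: \<open>d mod 2\<close> is the digit written,
    \<open>d \<ge> 2\<close> the new carry.\<close>
  define d where "d = of_bool (f h = 1) + of_bool (us ! k) + (of_bool c :: nat)"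
  let ?f = "f(h := d mod 2)"
  have o: "ones ?f \<le> ones f + 1" using ones_upd[OF Suc.prems(1), of h "d mod 2"] by (auto split: if_splits)
  have "addr ?f + 2 ^ h * of_bool (f h = 1) = addr f + 2 ^ h * (d mod 2)"
    using addr_upd[OF Suc.prems(1), of h "d mod 2"] by (auto split: if_splits)
  moreover have "d = d mod 2 + 2 * of_bool (d \<ge> 2)" by (simp add: d_def)
  then have "2 ^ h * d = 2 ^ h * (d mod 2 + 2 * of_bool (d \<ge> 2))" by (rule arg_cong)
  then have "2 ^ h * d = 2 ^ h * (d mod 2) + 2 ^ Suc h * of_bool (d \<ge> 2)" by (simp add: distrib_left)
  moreover have "drop k us = us ! k # drop (Suc k) us" using k by (simp add: Cons_nth_drop_Suc)
  ultimately have "addr ?f + 2 ^ Suc h * (of_bool (d \<ge> 2) + val (drop (Suc k) us)) = s"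
    using Suc.prems(2) by (simp add: d_def algebra_simps)
  then have "halts w (Sum (d \<ge> 2), (?f, Suc h), (store l us, Suc (Suc k)))
      (2 * ones ?f + 3 * (length us - Suc k) + 3) (s < length w)"
    using Suc.hyps(2) finite_ones_upd[OF Suc.prems(1)] by (intro Suc.hyps(1)) simp_all
  then show ?case
    by (rule halts_step) (use o k in \<open>simp_all add: store_digit digit_eq_iff d_def fun_upd_idem_iff\<close>)
qed

text \<open>Starting in cell 1 instead of cell 0 doubles the addend. If \<open>v\<close> is the
  address where \<open>y\<close> begins, the test compares \<open>i\<close> or \<open>2 * i\<close>
  with \<open>|y|\<close>.\<close>

lemma runs_add:
  assumes "3 * length us + 5 \<le> t"
  shows "runs w (Goal (Add d)) (store l us, 1) v t (v + (if d then 2 * val us else val us) < length w)"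
  unfolding runs_def
proof (intro allI impI)
  fix f assume "counter f v"
  then have f: "finite {j. f j = 1}" "addr f = v" by (auto simp: counter_def)
  have "halts w (Sum False, (f, if d then 1 else 0), (store l us, Suc 0))
      (2 * ones f + 3 * (length us - 0) + 3) (v + (if d then 2 * val us else val us) < length w)"
    using f by (intro sum_halts) auto
  then show "halts w (Goal (Add d), (f, 0), (store l us, 1)) (t + 2 * ones f)
      (v + (if d then 2 * val us else val us) < length w)"
    by (rule halts_step) (use assms in auto)
qed

lemma input_at_append:
  "w = us @ r \<Longrightarrow> input_at w (length us) = (case r of [] \<Rightarrow> None | x # _ \<Rightarrow> Some x)"
  by (auto simp: input_at_def nth_append split: list.split)

section \<open>What remains to be verified after the digits of \<open>i\<close>\<close>

fun goal_holds :: "goal \<Rightarrow> bool list \<Rightarrow> isym list \<Rightarrow> bool" where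
  "goal_holds (Add d) us y \<longleftrightarrow> (if d then 2 * val us else val us) < length y"
| "goal_holds Compare us y \<longleftrightarrow> (\<exists>z. y = map Bit us @ Sep # z \<and> val us < length z)"
| "goal_holds SkipBit us y \<longleftrightarrow> (\<exists>z. y = Bit True # map Bit us @ Sep # z \<and> val us < length z)"

lemma runs_compare:
  assumes "w = pre @ r" "k \<le> length us" "6 * (length us - k) + 4 * length us + 20 \<le> t"
  shows "runs w (Goal Compare) (store l us, Suc k) (length pre) t
    (\<exists>z. r = map Bit (drop k us) @ Sep # z \<and> val us < length z)"
  using assms
proof (induction r arbitrary: pre k t)
  case Nil
  have "runs w (Goal Compare) (store l us, Suc k) (length pre) t False"
    using Nil.prems(3) by (intro runs_reject) (simp_all add: input_at_append[OF Nil.prems(1)])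
  then show ?case by simp
next
  case (Cons x r)
  note input = input_at_append[OF Cons.prems(1)]
  show ?case
  proof (cases x)
    case (Bit c)
    show ?thesis
    proof (cases "k < length us \<and> us ! k = c")
      case True
      have "runs w (Goal Compare) (store l us, Suc (Suc k)) (length (pre @ [x])) (t - 6)
          (\<exists>z. r = map Bit (drop (Suc k) us) @ Sep # z \<and> val us < length z)"
        by (rule Cons.IH) (use Cons.prems True in auto)
      \<comment> \<open>A matching digit is written back, so the stored number survives for the
        addition.\<close>
      moreover have "(store l us)(Suc k := digit c) = store l us"
        using True by (auto simp: fun_upd_idem_iff store_digit)
      ultimately have "runs w (Goal Compare) (store l us, Suc k) (length pre) t
          (\<exists>z. r = map Bit (drop (Suc k) us) @ Sep # z \<and> val us < length z)"
        using True Cons.prems(3)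
        by (intro runs_advance[of _ _ _ _ _ "Goal Compare" "(digit c, Right)" "t - 6"])
          (simp_all add: input Bit store_digit)
      moreover have "drop k us = c # drop (Suc k) us" using True Cons_nth_drop_Suc[of k us] by simp
      ultimately show ?thesis by (simp add: Bit)
    next
      case False
      then have "store l us (Suc k) \<noteq> digit c"
        using Cons.prems(2) by (cases "k < length us") (auto simp: store_digit digit_eq_iff store_beyond digit_def)
      then have "runs w (Goal Compare) (store l us, Suc k) (length pre) t False"
        using Cons.prems(3) by (intro runs_reject) (simp_all add: input Bit)
      moreover have "\<nexists>z. x # r = map Bit (drop k us) @ Sep # z"
        using False Cons.prems(2) Bit by (cases "k < length us") (auto simp flip: Cons_nth_drop_Suc)
      ultimately show ?thesis by auto
    qed
  next
    case Sep
    show ?thesis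
    proof (cases "k < length us")
      case True
      then have "runs w (Goal Compare) (store l us, Suc k) (length pre) t False"
        using Cons.prems(3) by (intro runs_reject) (simp_all add: input Sep store_digit)
      moreover have "\<nexists>z. x # r = map Bit (drop k us) @ Sep # z"
        using True Sep by (auto simp flip: Cons_nth_drop_Suc)
      ultimately show ?thesis by auto
    next
      case False
      then have k: "k = length us" using Cons.prems(2) by simp
      \<comment> \<open>Behind the separator the counter points to the start of \<open>r\<close>, so
        plain addition tests \<open>val us < length r\<close>.\<close>
      have "runs w (Goal (Add False)) (store l us, 1) (Suc (length pre)) (3 * length us + 5)
          (Suc (length pre) + (if False then 2 * val us else val us) < length w)"
        by (rule runs_add) simp
      then have "runs w (Goal (Add False)) (store l us, 1) (Suc (length pre)) (3 * length us + 5)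
          (val us < length r)"
        using Cons.prems(1) by simp
      then have "runs w (Rewind (Add False)) (store l us, Suc k) (Suc (length pre)) (4 * length us + 7)
          (val us < length r)"
        by (rule runs_rewind) (simp add: k)
      moreover have "store l us (Suc k) \<notin> range digit"
        using k by (auto simp: store_beyond digit_def)
      ultimately have "runs w (Goal Compare) (store l us, Suc k) (length pre) t (val us < length r)"
        using Cons.prems(3)
        by (intro runs_advance[of _ _ _ _ _ "Rewind (Add False)" "(store l us (Suc k), Stay)"
              "4 * length us + 7"]) (simp_all add: input Sep)
      then show ?thesis by (simp add: k Sep)
    qed
  qed
qed

lemma runs_goal:
  assumes "w = pre @ r" "10 * length us + 30 \<le> t"
  shows "runs w (Goal g) (store l us, 1) (length pre) t (goal_holds g us r)"
proof (cases g)
  case (Add d)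
  show ?thesis using runs_add[of us t w d l "length pre"] assms Add by simp
next
  case Compare
  show ?thesis using runs_compare[of w pre r 0 us t l] assms Compare by simp
next
  case SkipBit
  show ?thesis
  proof (cases "\<exists>y. r = Bit True # y")
    case True
    then obtain y where y: "r = Bit True # y" by blast
    have "runs w (Goal Compare) (store l us, Suc 0) (length (pre @ [Bit True])) (t - 6)
        (\<exists>z. y = map Bit (drop 0 us) @ Sep # z \<and> val us < length z)"
      by (rule runs_compare) (use assms y in auto)
    then show ?thesis
      using assms(2) unfolding SkipBit
      by (intro runs_advance[of _ _ _ _ _ "Goal Compare" "(store l us 1, Stay)" "t - 6"])
        (simp_all add: input_at_append[OF assms(1)] y)
  next
    case False
    then have "runs w (Goal g) (store l us, 1) (length pre) t False"
      unfolding SkipBit using assms(2)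
      by (intro runs_reject) (auto simp: input_at_append[OF assms(1)] split: list.split)
    moreover have "\<not> goal_holds g us r" using False SkipBit by auto
    ultimately show ?thesis by simp
  qed
qed

section \<open>Copying the digits of \<open>i\<close> over the ruler\<close>

definition copied :: "nat \<Rightarrow> goal \<Rightarrow> bool list \<Rightarrow> bool \<Rightarrow> isym list \<Rightarrow> bool" where
  "copied l g us b r \<longleftrightarrow> (\<exists>u y. r = map Bit u @ Sep # y \<and> (if u = [] then b else last u) \<and>
     length us + length u \<le> l \<and> goal_holds g (us @ u) y)"

lemma copied_Nil: "\<not> copied l g us b []"
  by (simp add: copied_def)

lemma copied_Bit: "copied l g us b (Bit c # r) \<longleftrightarrow> length us < l \<and> copied l g (us @ [c]) c r"
proof
  assume "copied l g us b (Bit c # r)"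
  then obtain u y where u: "Bit c # r = map Bit u @ Sep # y" "if u = [] then b else last u"
    "length us + length u \<le> l" "goal_holds g (us @ u) y" by (auto simp: copied_def)
  then obtain u' where "u = c # u'" by (cases u) auto
  then show "length us < l \<and> copied l g (us @ [c]) c r"
    using u unfolding copied_def by (auto intro!: exI[of _ u'] split: if_splits)
next
  assume "length us < l \<and> copied l g (us @ [c]) c r"
  then obtain u y where "r = map Bit u @ Sep # y" "if u = [] then c else last u"
    "length us + Suc (length u) \<le> l" "goal_holds g (us @ c # u) y" by (auto simp: copied_def)
  then show "copied l g us b (Bit c # r)"
    unfolding copied_def by (intro exI[of _ "c # u"] exI[of _ y]) auto
qed

lemma copied_Sep: "length us \<le> l \<Longrightarrow> copied l g us b (Sep # r) \<longleftrightarrow> b \<and> goal_holds g us r"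
proof -
  have "Sep # r = map Bit u @ Sep # y \<longleftrightarrow> u = [] \<and> y = r" for u y by (cases u) auto
  then show "length us \<le> l \<Longrightarrow> ?thesis" by (auto simp: copied_def)
qed

text \<open>Here \<open>us\<close> is already stored and \<open>b\<close> guards the separator
  against a redundant zero; starting with \<open>True\<close> admits the empty representation of 0.
  The time is 6 for each free ruler cell, plus \<open>11 * l\<close> for rewinding and the goal, up
  to a constant.\<close>

lemma runs_copy:
  assumes "w = pre @ r" "length us \<le> l" "6 * (l - length us) + 11 * l + 40 \<le> t"
  shows "runs w (Copy g b) (store l us, Suc (length us)) (length pre) t (copied l g us b r)"
  using assms
proof (induction r arbitrary: pre us b t)
  case Nil
  have "runs w (Copy g b) (store l us, Suc (length us)) (length pre) t False"
    using Nil.prems(3) by (intro runs_reject) (simp_all add: input_at_append[OF Nil.prems(1)])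
  then show ?case by (simp add: copied_Nil)
next
  case (Cons x r)
  note input = input_at_append[OF Cons.prems(1)]
  show ?case
  proof (cases x)
    case (Bit c)
    show ?thesis
    proof (cases "length us < l")
      case True
      have "runs w (Copy g c) (store l (us @ [c]), Suc (length (us @ [c]))) (length (pre @ [x])) (t - 6)
          (copied l g (us @ [c]) c r)"
        by (rule Cons.IH) (use Cons.prems True in auto)
      then have "runs w (Copy g b) (store l us, Suc (length us)) (length pre) t
          (copied l g (us @ [c]) c r)"
        using True Cons.prems(3)
        by (intro runs_advance[of _ _ _ _ _ "Copy g c" "(digit c, Right)" "t - 6"])
          (simp_all add: input Bit store_beyond store_append)
      then show ?thesis using True by (simp add: Bit copied_Bit)
    next
      case False
      then have "runs w (Copy g b) (store l us, Suc (length us)) (length pre) t False"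
        using Cons.prems(3) by (intro runs_reject) (simp_all add: input Bit store_beyond)
      then show ?thesis using False by (simp add: Bit copied_Bit)
    qed
  next
    case Sep
    show ?thesis
    proof (cases b)
      case True
      have "runs w (Goal g) (store l us, 1) (length (pre @ [x])) (10 * length us + 30) (goal_holds g us r)"
        by (rule runs_goal) (use Cons.prems in simp_all)
      then have "runs w (Rewind g) (store l us, Suc (length us)) (length (pre @ [x])) (t - 6)
          (goal_holds g us r)"
        by (rule runs_rewind) (use Cons.prems in simp)
      then have "runs w (Copy g b) (store l us, Suc (length us)) (length pre) t (goal_holds g us r)"
        using True Cons.prems(3)
        by (intro runs_advance[of _ _ _ _ _ "Rewind g" "(store l us (Suc (length us)), Stay)" "t - 6"])
          (simp_all add: input Sep)
      then show ?thesis using True Cons.prems(2) by (simp add: Sep copied_Sep)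
    next
      case False
      then have "runs w (Copy g b) (store l us, Suc (length us)) (length pre) t False"
        using Cons.prems(3) by (intro runs_reject) (simp_all add: input Sep)
      then show ?thesis using False Cons.prems(2) by (simp add: Sep copied_Sep)
    qed
  qed
qed

section \<open>Scanning for a pattern\<close>

definition accepted :: "nat \<Rightarrow> isym list \<Rightarrow> bool" where
  "accepted l w \<longleftrightarrow> (\<exists>us \<in> accs. \<exists>y. w = us @ y) \<or>
     (\<exists>us g y. heads us = Some g \<and> w = us @ y \<and> copied l g [] True y)"

lemma accepted_pattern:
  assumes "accepted l w"
  obtains us y where "us \<in> accs \<union> dom heads" "w = us @ y"
  using assms unfolding accepted_def by blast

lemma accs_heads_disjoint: "us \<in> accs \<Longrightarrow> heads us = None"
  unfolding accs_def heads_def by (elim insertE emptyE) simp_all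

text \<open>Two prefixes of one word are comparable, and comparable patterns are equal by
  \<open>prefix_free\<close>.\<close>

lemma append_pattern_cases:
  assumes "p @ y = q @ z" "p \<in> accs \<union> dom heads" "q \<in> accs \<union> dom heads"
  shows "p = q \<and> y = z"
proof -
  have "(\<exists>v. p = q @ v) \<or> (\<exists>v. q = p @ v)" using assms(1) by (auto simp: append_eq_append_conv2)
  then have "p = q" using prefix_free[of p] prefix_free[of q] assms(2,3) by auto
  then show ?thesis using assms(1) by simp
qed

text \<open>The nonempty \<open>vs\<close> says that \<open>us\<close> is a proper prefix of a
  pattern, so by prefix-freeness no pattern has been completed yet. At most 13 symbols are scanned,
  at cost 6 each.\<close>

lemma runs_scan:
  assumes "w = us @ r" "vs \<noteq> []" "us @ vs \<in> accs \<union> dom heads"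
    "6 * (13 - length us) + 17 * l + 50 \<le> t"
  shows "runs w (Scan us) (store l [], 1) (length us) t (accepted l w)"
  using assms
proof (induction r arbitrary: us vs t)
  case Nil
  have "\<not> accepted l w"
  proof
    assume "accepted l w"
    then obtain p y where p: "p \<in> accs \<union> dom heads" "w = p @ y" by (rule accepted_pattern)
    then have "p @ y @ vs = (us @ vs) @ []" using Nil.prems(1) by simp
    then show False using append_pattern_cases[of p "y @ vs" "us @ vs" "[]"] p Nil.prems(2,3) by auto
  qed
  moreover have "runs w (Scan us) (store l [], 1) (length us) t False"
    using Nil.prems(4) by (intro runs_reject) (simp_all add: input_at_append[OF Nil.prems(1)])
  ultimately show ?case by simp
next
  case (Cons x r)
  note input = input_at_append[OF Cons.prems(1)]
  have w: "w = (us @ [x]) @ r" using Cons.prems(1) by simp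
  consider "us @ [x] \<in> accs" | g where "heads (us @ [x]) = Some g"
    | v vs where "us @ [x] \<notin> accs \<union> dom heads" "(us @ [x]) @ v # vs \<in> accs \<union> dom heads"
    | "\<nexists>vs. us @ [x] @ vs \<in> accs \<union> dom heads"
  proof (cases "us @ [x] \<in> accs \<union> dom heads")
    case False
    show thesis
    proof (cases "\<exists>vs. us @ [x] @ vs \<in> accs \<union> dom heads")
      case True
      then obtain vs where "us @ [x] @ vs \<in> accs \<union> dom heads" by blast
      then show thesis using that(3) False by (cases vs) auto
    qed (use that in blast)
  qed (use that in blast)
  then show ?case
  proof cases
    case 1
    then have "accepted l w" using w unfolding accepted_def by blast
    moreover have "runs w (Scan us) (store l [], 1) (length us) t True"
      unfolding runs_def
    proof (intro allI impI)
      fix f assume "counter f (length us)"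
      then have "addr f = length us" by (simp add: counter_def)
      then show "halts w (Scan us, (f, 0), store l [], 1) (t + 2 * ones f) True"
        using Cons.prems(4) 1
        by (intro halts_step[OF halts_Acc[of w "((f, 0), (store l [], 1))" 0]]) (simp_all add: input)
    qed
    ultimately show ?thesis by simp
  next
    case (2 g)
    then have "accepted l w \<longleftrightarrow> copied l g [] True r"
      unfolding accepted_def using w append_pattern_cases[of _ _ "us @ [x]" r] accs_heads_disjoint
      by (smt (verit, del_insts) UnCI domI option.distinct(1) option.inject)
    moreover have "runs w (Copy g True) (store l [], Suc (length ([] :: bool list))) (length (us @ [x])) (t - 6)
        (copied l g [] True r)"
      by (rule runs_copy) (use w Cons.prems in auto)
    then have "runs w (Scan us) (store l [], 1) (length us) t (copied l g [] True r)"
      using Cons.prems(4) 2 accs_heads_disjoint[of "us @ [x]"]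
      by (intro runs_advance[of _ _ _ _ _ "Copy g True" "(store l [] 1, Stay)" "t - 6"])
        (auto simp: input)
    ultimately show ?thesis by simp
  next
    case (3 v vs)
    have "length (us @ [x]) < 13" using length_pattern[OF 3(2)] by simp
    have "runs w (Scan (us @ [x])) (store l [], 1) (length (us @ [x])) (t - 6) (accepted l w)"
      by (rule Cons.IH[of _ "v # vs"]) (use w 3 Cons.prems(4) \<open>length (us @ [x]) < 13\<close> in auto)
    moreover have "delta (Scan us) (Some x) s (store l [] 1) =
        advance (Scan (us @ [x])) s (store l [] 1, Stay)" for s
    proof -
      have "us @ [x] \<notin> accs" "heads (us @ [x]) = None" using 3(1) by auto
      moreover have "\<exists>vs. us @ [x] @ vs \<in> accs \<union> dom heads" using 3(2) by auto
      ultimately show ?thesis by (simp only: delta.simps option.case if_False if_True)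
    qed
    ultimately show ?thesis
      using Cons.prems(4) \<open>length (us @ [x]) < 13\<close>
      by (intro runs_advance[of _ _ _ _ _ "Scan (us @ [x])" "(store l [] 1, Stay)" "t - 6"])
        (simp_all add: input del: delta.simps)
  next
    case 4
    have "\<not> accepted l w"
    proof
      assume "accepted l w"
      then obtain p y where p: "p \<in> accs \<union> dom heads" "w = p @ y" by (rule accepted_pattern)
      then have "p @ y = us @ x # r" using Cons.prems(1) by simp
      \<comment> \<open>A pattern at the start of \<open>w\<close> either continues
        \<open>us\<close> by \<open>x\<close>, which is excluded, or is a prefix of
        \<open>us\<close>, against prefix-freeness.\<close>
      then consider v where "p = us @ v" "v @ y = x # r" | v where "us = p @ v"
        by (auto simp: append_eq_append_conv2)
      then show False
      proof cases
        case 1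
        then show False using 4 p(1) prefix_free[of us vs] Cons.prems(2,3)
          by (cases v) auto
      next
        case 2
        then show False using prefix_free[of p "v @ vs"] p(1) Cons.prems(2,3) by simp
      qed
    qed
    moreover have "delta (Scan us) (Some x) s (store l [] 1) = reject s (store l [] 1)" for s
    proof -
      have "us @ [x] @ [] \<notin> accs \<union> dom heads" using 4 by blast
      then have "us @ [x] \<notin> accs" "heads (us @ [x]) = None" by auto
      with 4 show ?thesis by (simp only: delta.simps option.case if_False)
    qed
    then have "runs w (Scan us) (store l [], 1) (length us) t False"
      using Cons.prems(4) by (intro runs_reject) (simp_all add: input del: delta.simps)
    ultimately show ?thesis by simp
  qed
qed

section \<open>The language of the machine\<close>

text \<open>With the least significant digit first, a redundant zero would be the last entry; these
  are exactly the values of \<open>binary\<close>.\<close>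

abbreviation canonical :: "bool list \<Rightarrow> bool" where
  "canonical us \<equiv> us = [] \<or> last us"

lemma binary_double_Suc: "binary (2 * n + 1) = True # binary n"
  by (subst binary.simps) simp

lemma binary_double: "0 < n \<Longrightarrow> binary (2 * n) = False # binary n"
  by (subst binary.simps) simp

lemma binary_0: "binary 0 = []"
  by (subst binary.simps) simp

lemma val_binary: "val (binary n) = n"
proof (induction n rule: binary.induct)
  case (1 n)
  then show ?case by (subst binary.simps) (auto simp: of_bool_def; presburger)
qed

lemma canonical_binary: "canonical (binary n)"
proof (induction n rule: binary.induct)
  case (1 n)
  show ?case
  proof (cases "n div 2 = 0")
    case True
    then have "n = 0 \<or> n = 1" by auto
    then show ?thesis using binary_double_Suc[of 0] by (auto simp: binary_0)
  next
    case False
    then have "binary (n div 2) \<noteq> []" by (subst binary.simps) simp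
    then show ?thesis using 1 False by (subst binary.simps) (auto simp: binary.simps[of n])
  qed
qed

lemma val_pos: "canonical us \<Longrightarrow> us \<noteq> [] \<Longrightarrow> 0 < val us"
  by (induction us) (auto split: if_splits)

lemma binary_val: "canonical us \<Longrightarrow> binary (val us) = us"
proof (induction us)
  case (Cons b us)
  then have "binary (val us) = us" by (cases us) auto
  moreover have "b \<or> 0 < val us" using Cons.prems val_pos[of us] by (cases us) auto
  ultimately show ?case
    by (cases b) (use binary_double_Suc[of "val us"] binary_double[of "val us"] in simp_all)
qed (simp add: binary_0)

lemma length_canonical_le: "canonical us \<Longrightarrow> val us < 2 ^ l \<Longrightarrow> length us \<le> l"
proof (induction us arbitrary: l)
  case (Cons b us)
  show ?case
  proof (cases l)
    case 0
    then show ?thesis using Cons.prems val_pos[OF Cons.prems(1)] by simp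
  next
    case (Suc l')
    then show ?thesis using Cons.IH[of l'] Cons.prems by (cases us) auto
  qed
qed simp

lemma goal_holds_less: "goal_holds g us y \<Longrightarrow> val us < length y"
  by (cases g) (auto split: if_splits)

text \<open>The ruler excludes no valid connection: the goal forces \<open>i < length y\<close>,
  hence \<open>i < 2 ^ l\<close>, and then the digits of \<open>i\<close> fit into \<open>l\<close>
  cells.\<close>

lemma copied_binary:
  assumes "length r \<le> 2 ^ l"
  shows "copied l g [] True r \<longleftrightarrow> (\<exists>i y. r = map Bit (binary i) @ Sep # y \<and> goal_holds g (binary i) y)"
proof
  assume "copied l g [] True r"
  then obtain u y where "r = map Bit u @ Sep # y" "canonical u" "goal_holds g u y"
    by (auto simp: copied_def split: if_splits)
  then show "\<exists>i y. r = map Bit (binary i) @ Sep # y \<and> goal_holds g (binary i) y"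
    by (intro exI[of _ "val u"] exI[of _ y]) (simp add: binary_val)
next
  assume "\<exists>i y. r = map Bit (binary i) @ Sep # y \<and> goal_holds g (binary i) y"
  then obtain i y where y: "r = map Bit (binary i) @ Sep # y" "goal_holds g (binary i) y" by blast
  then have "i < 2 ^ l" using goal_holds_less[OF y(2)] assms by (simp add: val_binary)
  then have "length (binary i) \<le> l"
    using canonical_binary[of i] by (intro length_canonical_le) (simp_all add: val_binary)
  then show "copied l g [] True r"
    unfolding copied_def using y canonical_binary[of i]
    by (intro exI[of _ "binary i"] exI[of _ y]) auto
qed

text \<open>The seven kinds of connection correspond to the seven patterns in \<open>accs\<close>
  and \<open>dom heads\<close>.\<close>

lemma DCL_zo_circuit:
  "w \<in> DCL zo_circuit \<longleftrightarrow>
    (\<exists>y. w = encode 3 0 4 y \<or> w = encode 5 4 8 y \<or> w = encode 0 8 1 y \<or>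
      (\<exists>i. 2 * i < length y \<and> w = encode 3 0 (4 * i + 2) y) \<or>
      (\<exists>i < length y. w = encode 5 4 (2 * i + 1) y \<or> w = encode 2 (4 * i + 2) (2 * i + 1) y \<or>
         w = encode 1 (2 * i + 1) i y))"
proof -
  have "(\<exists>a b. w = encode (gate_type (label (zo_circuit n) a)) a b y \<and>
          a \<in> nodes (zo_circuit n) \<and> b \<in> connections (zo_circuit n) a) \<longleftrightarrow>
      w = encode 3 0 4 y \<or> w = encode 5 4 8 y \<or> w = encode 0 8 1 y \<or>
      (\<exists>i. 2 * i < n \<and> w = encode 3 0 (4 * i + 2) y) \<or>
      (\<exists>i < n. w = encode 5 4 (2 * i + 1) y \<or> w = encode 2 (4 * i + 2) (2 * i + 1) y \<or>
         w = encode 1 (2 * i + 1) i y)" for n y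
  proof -
    let ?C = "zo_circuit n"
    have odd: "label ?C (2 * i + 1) = GVar i" "connections ?C (2 * i + 1) = {i}" for i
    proof -
      have "2 * i + 1 \<noteq> 4" "2 * i + 1 \<noteq> 8" by presburger+
      then show "label ?C (2 * i + 1) = GVar i" "connections ?C (2 * i + 1) = {i}"
        by (simp_all add: zo_circuit_def connections_def)
    qed
    have even: "label ?C (4 * i + 2) = GNot" "connections ?C (4 * i + 2) = {2 * i + 1}" for i
    proof -
      have "4 * i + 2 \<noteq> 4" "4 * i + 2 \<noteq> 8" "(4 * i + 2) div 2 = 2 * i + 1" by presburger+
      then show "label ?C (4 * i + 2) = GNot" "connections ?C (4 * i + 2) = {2 * i + 1}"
        by (simp_all add: zo_circuit_def connections_def)
    qed
    have const: "label ?C 0 = GAnd" "connections ?C 0 = insert 4 {4 * i + 2 | i. 2 * i < n}"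
        "label ?C 4 = GMaj" "connections ?C 4 = insert 8 {2 * i + 1 | i. i < n}"
        "label ?C 8 = GConst True" "connections ?C 8 = {1}"
      by (simp_all add: zo_circuit_def connections_def)
    have nodes: "nodes ?C = {0, 4, 8} \<union> {2 * i + 1 | i. i < n} \<union> {4 * i + 2 | i. i < n}"
      by (simp add: zo_circuit_def)
    have "(\<exists>a b. w = encode (gate_type (label ?C a)) a b y \<and> a \<in> nodes ?C \<and> b \<in> connections ?C a) \<longleftrightarrow>
        (\<exists>a \<in> nodes ?C. \<exists>b \<in> connections ?C a. w = encode (gate_type (label ?C a)) a b y)" by blast
    also have "\<dots> \<longleftrightarrow> (\<exists>a \<in> {0, 4, 8}. \<exists>b \<in> connections ?C a. w = encode (gate_type (label ?C a)) a b y)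
        \<or> (\<exists>i < n. w = encode 1 (2 * i + 1) i y) \<or> (\<exists>i < n. w = encode 2 (4 * i + 2) (2 * i + 1) y)"
      unfolding nodes using odd even by (auto simp: Bex_def)
    also have "(\<exists>a \<in> {0, 4, 8}. \<exists>b \<in> connections ?C a. w = encode (gate_type (label ?C a)) a b y) \<longleftrightarrow>
        w = encode 3 0 4 y \<or> (\<exists>i. 2 * i < n \<and> w = encode 3 0 (4 * i + 2) y) \<or>
        w = encode 5 4 8 y \<or> (\<exists>i < n. w = encode 5 4 (2 * i + 1) y) \<or> w = encode 0 8 1 y"
      using const by auto
    finally show ?thesis by blast
  qed
  then show ?thesis unfolding DCL_def by blast
qed

lemma accepted_iff_DCL:
  assumes "length w \<le> 2 ^ l"
  shows "accepted l w \<longleftrightarrow> w \<in> DCL zo_circuit"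
proof -
  have bin: "binary 1 = [True]" "binary 2 = [False, True]" "binary 3 = [True, True]"
      "binary 4 = [False, False, True]" "binary 5 = [True, False, True]"
      "binary 8 = [False, False, False, True]" "binary (2 * i + 1) = True # binary i"
      "binary (4 * i + 2) = False # True # binary i" for i
    using binary_double[of "2 * i + 1"] binary_double_Suc[of i]
    by (simp_all add: binary.simps)
  have head: "(\<exists>r. w = us @ r \<and> copied l g [] True r) \<longleftrightarrow>
      (\<exists>i y. w = us @ map Bit (binary i) @ Sep # y \<and> goal_holds g (binary i) y)" for us g
  proof -
    have "copied l g [] True r \<longleftrightarrow>
        (\<exists>i y. r = map Bit (binary i) @ Sep # y \<and> goal_holds g (binary i) y)" if "w = us @ r" for r
      using that assms by (intro copied_binary) simp
    then show ?thesis by blast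
  qed
  have accs: "(\<exists>us \<in> accs. \<exists>y. w = us @ y) \<longleftrightarrow>
      (\<exists>y. w = encode 3 0 4 y \<or> w = encode 5 4 8 y \<or> w = encode 0 8 1 y)"
    unfolding accs_def encode_def bin binary_0 by auto
  have heads: "(\<exists>us g y. heads us = Some g \<and> w = us @ y \<and> copied l g [] True y) \<longleftrightarrow>
      (\<exists>us \<in> dom heads. \<exists>y. w = us @ y \<and> copied l (the (heads us)) [] True y)" by force
  have "\<dots> \<longleftrightarrow>
      (\<exists>i y. w = encode 3 0 (4 * i + 2) y \<and> 2 * i < length y) \<or>
      (\<exists>i y. w = encode 5 4 (2 * i + 1) y \<and> i < length y) \<or>
      (\<exists>i y. w = encode 2 (4 * i + 2) (2 * i + 1) y \<and> i < length y) \<or>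
      (\<exists>i y. w = encode 1 (2 * i + 1) i y \<and> i < length y)"
    unfolding dom_heads bex_simps head encode_def bin binary_0
    by (simp add: heads_def val_binary) blast
  then show ?thesis
    unfolding accepted_def accs heads DCL_zo_circuit by blast
qed

section \<open>Initialisation and encoding of the states\<close>

text \<open>The least \<open>l\<close> for which the probed address \<open>2 ^ l - 2\<close> lies
  outside an input of length \<open>n\<close>.\<close>

definition ell :: "nat \<Rightarrow> nat" where
  "ell n = (LEAST l. n + 2 \<le> 2 ^ l)"

lemma ell_least: "n + 2 \<le> 2 ^ l \<longleftrightarrow> ell n \<le> l"
proof
  show "n + 2 \<le> 2 ^ l \<Longrightarrow> ell n \<le> l" unfolding ell_def by (rule Least_le)
  have "n + 2 \<le> 2 ^ (n + 2)" using less_exp[of "n + 2"] by (rule less_imp_le)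
  then have "n + 2 \<le> 2 ^ ell n" unfolding ell_def by (rule LeastI)
  then show "ell n \<le> l \<Longrightarrow> n + 2 \<le> 2 ^ l"
    using power_increasing[of "ell n" l "2 :: nat"] by linarith
qed

lemma ell_pos: "0 < ell n"
  using ell_least[of n 0] by (cases "ell n") auto

lemma ell_bigo: "(\<lambda>n. real (20 * ell n + 140)) \<in> O(\<lambda>n. ln (real n))"
proof (rule bigoI)
  show "\<forall>\<^sub>F n in sequentially. norm (real (20 * ell n + 140)) \<le> 200 / ln 2 * norm (ln (real n))"
  proof (rule eventually_sequentiallyI)
    fix n :: nat assume n: "2 \<le> n"
    have "\<not> n + 2 \<le> 2 ^ (ell n - 1)" using ell_least[of n "ell n - 1"] ell_pos[of n] by simp
    \<comment> \<open>Minimality of \<open>ell n\<close> bounds it by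
      \<open>1 + 2 * log 2 n\<close>, hence by \<open>3 * log 2 n\<close> for
      \<open>n \<ge> 2\<close>; the factor 200 is \<open>20 * 3 + 140\<close>.\<close>
    then have "2 ^ (ell n - 1) \<le> n + n" using n by linarith
    also have "n + n \<le> n ^ 2" using n by (simp add: power2_eq_square flip: mult_2)
    finally have "real (2 ^ (ell n - 1)) \<le> real (n ^ 2)" by (rule of_nat_mono)
    then have "ln (2 ^ (ell n - 1)) \<le> ln (real n ^ 2)" using n by (subst ln_le_cancel_iff) auto
    then have "real (ell n - 1) * ln 2 \<le> 2 * ln (real n)" using n by (simp add: ln_realpow)
    moreover have "ln 2 \<le> ln (real n)" using n by simp
    ultimately have "real (ell n) * ln 2 \<le> 3 * ln (real n)"
      using ell_pos[of n] by (simp add: of_nat_diff algebra_simps)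
    then have "(20 * real (ell n) + 140) * ln 2 \<le> 200 * ln (real n)"
      using \<open>ln 2 \<le> ln (real n)\<close> by (simp add: algebra_simps)
    then show "norm (real (20 * ell n + 140)) \<le> 200 / ln 2 * norm (ln (real n))"
      using n by (simp add: field_simps)
  qed
qed

text \<open>One shape for both tapes: \<open>ruler 1 2 h\<close> on tape 1, and on tape 0
  \<open>ruler 2 1 h\<close>, the binary number \<open>2 ^ h - 2\<close> for
  \<open>h > 0\<close>.\<close>

definition ruler :: "nat \<Rightarrow> nat \<Rightarrow> nat \<Rightarrow> nat \<Rightarrow> nat" where
  "ruler a b h j = (if j = 0 then a else if j < h then b else 0)"

lemma ruler_upd: "0 < h \<Longrightarrow> (ruler a b h)(h := b) = ruler a b (Suc h)"
  by (rule ext) (auto simp: ruler_def less_Suc_eq)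

lemma ruler_upd_0: "0 < h \<Longrightarrow> (ruler a b (Suc h))(h := 0) = ruler a b h"
  by (rule ext) (auto simp: ruler_def less_Suc_eq)

lemma ruler_beyond: "0 < h \<Longrightarrow> ruler a b h h = 0"
  by (simp add: ruler_def)

lemma ruler_0: "ruler a b h 0 = a"
  by (simp add: ruler_def)

lemma finite_ruler: "finite {j. ruler 2 1 h j = 1}"
  by (rule finite_subset[of _ "{..<h}"]) (auto simp: ruler_def split: if_splits)

lemma addr_ruler: "0 < h \<Longrightarrow> addr (ruler 2 1 h) + 2 = 2 ^ h"
proof (induction h)
  case (Suc h)
  show ?case
  proof (cases "h = 0")
    case True
    then have "ruler 2 1 (Suc h) j \<noteq> 1" for j by (simp add: ruler_def)
    then show ?thesis using True by (simp add: addr_def)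
  next
    case False
    then have "addr (ruler 2 1 (Suc h)) = addr (ruler 2 1 h) + 2 ^ h"
      using addr_upd[of "ruler 2 1 h" h 1, OF finite_ruler] ruler_beyond[of h 2 1] by (simp add: ruler_upd)
    then show ?thesis using Suc.IH False by simp
  qed
qed simp

lemma store_Nil: "store l [] = ruler 1 2 (Suc l)"
  by (rule ext) (simp add: store_def ruler_def less_Suc_eq_le)

text \<open>Both heads walk back in step until the 2 in cell 0 of tape 0 is met; the counter is then
  0, and the last step puts the head of tape 1 on the first ruler cell.\<close>

lemma erase_halts:
  assumes "halts w (Scan [], (ruler 2 1 1, 0), (g, 1)) t V"
  shows "halts w (Erase, (ruler 2 1 (Suc h), h), (g, h)) (t + h + 1) V"
proof (induction h)
  case 0
  show ?case
    by (rule halts_step[OF assms]) (simp_all add: ruler_0 fun_upd_idem_iff)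
next
  case (Suc h)
  show ?case
    by (rule halts_step[OF Suc.IH]) (simp_all add: ruler_upd_0, simp_all add: ruler_def)
qed

text \<open>
  The ruler is laid out by probing the addresses \<open>2 ^ h - 2\<close> until the input is exceeded.
\<close>

lemma probe_halts:
  assumes "halts w (Scan [], (ruler 2 1 1, 0), (store (ell (length w)) [], 1)) t V"
    "0 < h" "h \<le> ell (length w)"
  shows "halts w (Probe, (ruler 2 1 h, h), (ruler 1 2 h, h)) (t + 2 * ell (length w) + 1 - h) V"
  using assms(2,3)
proof (induction "ell (length w) - h" arbitrary: h)
  case 0
  let ?l = "ell (length w)"
  have h: "h = ?l" using 0 by simp
  have l: "0 < ?l" by (rule ell_pos)
  have bound: "\<not> addr (ruler 2 1 ?l) < length w"
    using ell_least[of "length w" ?l] addr_ruler[OF l] by simp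
  have "halts w (Erase, (ruler 2 1 (Suc (?l - 1)), ?l - 1), (store ?l [], ?l - 1))
      (t + (?l - 1) + 1) V"
    by (rule erase_halts[OF assms(1)])
  then have erase: "halts w (Erase, (ruler 2 1 ?l, ?l - 1), (store ?l [], ?l - 1)) (t + ?l) V"
    using l by simp
  \<comment> \<open>The probe that leaves the input still extends tape 1, so the ruler gets
    \<open>?l\<close> cells, but it writes only a blank on tape 0.\<close>
  moreover have "(ruler 2 1 ?l)(?l := 0) = ruler 2 1 ?l" 
    using ruler_beyond[OF l] by (simp add: fun_upd_idem_iff)
  ultimately show ?case unfolding h
    by (intro halts_step[OF erase]) (use l bound in \<open>simp_all add: input_at_def store_Nil ruler_upd\<close>)
next
  case (Suc n)
  then have h: "Suc h \<le> ell (length w)" by simp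
  have probe: "halts w (Probe, (ruler 2 1 (Suc h), Suc h), (ruler 1 2 (Suc h), Suc h))
      (t + 2 * ell (length w) + 1 - Suc h) V"
    by (rule Suc.hyps(1)) (use Suc.hyps(2) h in simp_all)
  have "\<not> length w + 2 \<le> 2 ^ h" using ell_least[of "length w" h] h by simp
  then have "addr (ruler 2 1 h) < length w" using addr_ruler[of h] Suc.prems by simp
  then show ?case
    by (intro halts_step[OF probe]) (use h Suc.prems in \<open>simp_all add: input_at_def ruler_upd\<close>)
qed

lemma init_halts:
  "halts w (Init, ((\<lambda>_. 0), 0), ((\<lambda>_. 0), 0)) (20 * ell (length w) + 140) (accepted (ell (length w)) w)"
proof -
  let ?l = "ell (length w)"
  \<comment> \<open>Any pattern shows that the empty word is a proper prefix of one. The constant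
    below is \<open>6 * 13 + 50 = 128\<close>.\<close>
  obtain us where us: "us \<in> accs" "us \<noteq> []" by (auto simp: accs_def)
  then have "runs w (Scan []) (store ?l [], 1) (length ([] :: isym list)) (17 * ?l + 128) (accepted ?l w)"
    by (intro runs_scan[of w "[]" w us]) auto
  moreover have no: "ruler 2 1 1 j \<noteq> 1" for j by (simp add: ruler_def)
  then have "counter (ruler 2 1 1) 0"
    using finite_ruler[of 1] by (simp add: counter_def addr_def) (simp add: ruler_def)
  moreover have "ones (ruler 2 1 1) = 0" using no by (simp add: ones_def)
  ultimately have "halts w (Scan [], (ruler 2 1 1, 0), (store ?l [], 1)) (17 * ?l + 128) (accepted ?l w)"
    unfolding runs_def by fastforce
  then have probe: "halts w (Probe, (ruler 2 1 1, 1), (ruler 1 2 1, 1)) (17 * ?l + 128 + 2 * ?l + 1 - 1)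
      (accepted ?l w)"
    using ell_pos[of "length w"] by (intro probe_halts) simp_all
  have "(\<lambda>_. 0)(0 := a) = ruler a b 1" for a b by (rule ext) (simp add: ruler_def)
  then show ?thesis
    by (intro halts_step[OF probe]) simp_all
qed

section \<open>Numbering the states\<close>

definition machine :: "(st \<Rightarrow> nat) \<Rightarrow> tm" where
  "machine e =
     \<lparr>tm_tapes = 2, tm_symbols = 5, tm_states = card (Collect valid_state),
      tm_start = e Init, tm_accept = e Acc, tm_reject = e Rej,
      tm_delta = (\<lambda>q x ss. let (q', y, z) = delta (inv_into (Collect valid_state) e q) x (ss ! 0) (ss ! 1)
                          in (e q', [y, z]))\<rparr>"

lemma wf_machine:
  assumes e: "bij_betw e (Collect valid_state) {..<card (Collect valid_state)}"
  shows "wf_tm (machine e)"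
proof -
  let ?Q = "(Collect valid_state)"
  have lt: "e q < card ?Q" if "valid_state q" for q
    using bij_betw_apply[OF e] that by auto
  have "e Acc \<noteq> e Rej" using bij_betw_imp_inj_on[OF e] by (auto dest: inj_onD)
  moreover have "q' < card ?Q \<and> length acts = 2 \<and> fst ` set acts \<subseteq> {..<5}"
    if q: "q < card ?Q" and ss: "length ss = 2" "set ss \<subseteq> {..<5}"
      and d: "tm_delta (machine e) q x ss = (q', acts)" for q x ss q' acts
  proof -
    let ?p = "inv_into ?Q e q"
    have p: "valid_state ?p"
      using inv_into_into[of q e ?Q] q bij_betw_imp_surj_on[OF e] by simp
    obtain p' s' m r' m' where p': "delta ?p x (ss ! 0) (ss ! 1) = (p', (s', m), (r', m'))"
      by (metis prod.exhaust)
    have "valid_state p'" using delta_valid_state[OF p, of x "ss ! 0" "ss ! 1"] p' by simp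
    moreover have "ss ! 0 \<in> set ss" "ss ! 1 \<in> set ss" using ss(1) by simp_all
    then have "ss ! 0 < 5" "ss ! 1 < 5" using ss(2) by auto
    then have "s' < 5 \<and> r' < 5" using delta_symbols[of "ss ! 0" "ss ! 1" ?p x] p' by simp
    moreover have "q' = e p'" "acts = [(s', m), (r', m')]" using d p' by (simp_all add: machine_def)
    ultimately show ?thesis using lt by simp
  qed
  moreover have "tm_tapes (machine e) = 2" "tm_symbols (machine e) = 5" "tm_start (machine e) = e Init"
      "tm_states (machine e) = card ?Q" "tm_accept (machine e) = e Acc" "tm_reject (machine e) = e Rej"
    by (simp_all add: machine_def)
  ultimately show ?thesis
    unfolding wf_tm_def using lt by (simp, blast)
qed

lemma step_valid_state: "valid_state (fst c) \<Longrightarrow> valid_state (fst (step w c))"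
proof -
  obtain q f h g k where c: "c = (q, (f, h), (g, k))" by (metis prod.exhaust)
  obtain q' y z where "delta q (input_at w (addr f)) (f h) (g k) = (q', y, z)"
    by (metis prod.exhaust)
  then show "valid_state (fst c) \<Longrightarrow> valid_state (fst (step w c))"
    using delta_valid_state[of q "input_at w (addr f)" "f h" "g k"] by (simp add: c)
qed

text \<open>Simulation step by step. In final states \<open>tm_step\<close> stops by definition, and
  \<open>step\<close> because \<open>delta\<close> changes nothing there.\<close>

lemma tm_step_machine:
  assumes e: "bij_betw e (Collect valid_state) {..<card (Collect valid_state)}" and "valid_state (fst c)"
  shows "tm_step (machine e) w (e (fst c), [fst (snd c), snd (snd c)]) =
    (e (fst (step w c)), [fst (snd (step w c)), snd (snd (step w c))])"
proof -
  let ?Q = "(Collect valid_state)"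
  obtain q f h g k where c: "c = (q, (f, h), (g, k))" by (metis prod.exhaust)
  have inj: "e q = e p \<longleftrightarrow> q = p" if "valid_state p" for p
    using assms(2) that bij_betw_imp_inj_on[OF e] by (auto simp: c dest: inj_onD)
  have "inv_into ?Q e (e q) = q"
    using bij_betw_imp_inj_on[OF e] assms(2) by (intro inv_into_f_f) (simp_all add: c)
  moreover have "input_sym w [(f, h), (g, k)] = input_at w (addr f)"
    by (simp add: input_sym_def input_at_def address_def addr_def)
  ultimately show ?thesis
    by (cases "q = Acc \<or> q = Rej")
      (auto simp: c inj machine_def reject_def split: prod.split)
qed

lemma tm_steps_machine:
  assumes e: "bij_betw e (Collect valid_state) {..<card (Collect valid_state)}" and "valid_state (fst c)"
  shows "(tm_step (machine e) w ^^ n) (e (fst c), [fst (snd c), snd (snd c)]) =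
      (e (fst ((step w ^^ n) c)), [fst (snd ((step w ^^ n) c)), snd (snd ((step w ^^ n) c))]) \<and>
    valid_state (fst ((step w ^^ n) c))"
proof (induction n)
  case (Suc n)
  then show ?case using tm_step_machine[OF e, of "(step w ^^ n) c" w] step_valid_state by simp
qed (use assms(2) in simp)

lemma halted_stays: "fst c \<in> {Acc, Rej} \<Longrightarrow> (step w ^^ n) c = c"
proof (induction n)
  case (Suc n)
  obtain q f h g k where "c = (q, (f, h), (g, k))" by (metis prod.exhaust)
  then show ?case using Suc by (auto simp: reject_def)
qed simp

lemma accepted_in_DLOGTIME: "{w. accepted (ell (length w)) w} \<in> DLOGTIME"
proof -
  let ?Q = "(Collect valid_state)" and ?T = "\<lambda>n. 20 * ell n + 140"
  obtain e where e: "bij_betw e ?Q {..<card ?Q}"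
    using ex_bij_betw_finite_nat[OF finite_valid_states] by (auto simp: atLeast0LessThan)
  let ?M = "machine e"
  have "fst ((tm_step ?M w ^^ ?T (length w)) (tm_init ?M)) =
      (if accepted (ell (length w)) w then tm_accept ?M else tm_reject ?M)" for w
  proof -
    let ?c = "(Init, ((\<lambda>_. 0 :: nat), 0 :: nat), ((\<lambda>_. 0 :: nat), 0 :: nat))"
    obtain k where k: "k \<le> ?T (length w)"
      "fst ((step w ^^ k) ?c) = (if accepted (ell (length w)) w then Acc else Rej)"
      using init_halts[of w] unfolding halts_def by blast
    \<comment> \<open>\<open>tm_decides\<close> inspects the state after exactly
      \<open>?T (length w)\<close> steps, so the verdict reached after \<open>k\<close> steps must
      persist.\<close>
    have "(step w ^^ ?T (length w)) ?c = (step w ^^ (?T (length w) - k)) ((step w ^^ k) ?c)"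
      using k(1) by (simp flip: funpow_add[THEN fun_cong, unfolded comp_apply])
    also have "\<dots> = (step w ^^ k) ?c" using k(2) by (intro halted_stays) simp
    finally have "(step w ^^ ?T (length w)) ?c = (step w ^^ k) ?c" .
    moreover have "tm_init ?M = (e (fst ?c), [fst (snd ?c), snd (snd ?c)])"
      by (simp add: tm_init_def machine_def numeral_2_eq_2)
    ultimately show ?thesis
      using tm_steps_machine[OF e, where c = ?c and w = w and n = "?T (length w)"] k(2) by (simp add: machine_def)
  qed
  then have "tm_decides ?M ?T {w. accepted (ell (length w)) w}" by (simp add: tm_decides_def)
  then show ?thesis
    unfolding DLOGTIME_def using wf_machine[OF e] ell_bigo
    by (intro CollectI exI[of _ ?M] exI[of _ ?T] conjI)
qed

theorem proposition4:
  "{replicate n False @ replicate n True | n. n \<ge> 0} \<in> uniform_TC0 \<and>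
   \<not> (\<exists>\<sigma> :: bool fm. sentence \<sigma> \<and>
        fm_lang \<sigma> = {replicate n False @ replicate n True | n. n \<ge> 0})"
proof
  have "accepted (ell (length w)) w \<longleftrightarrow> w \<in> DCL zo_circuit" for w
  proof -
    have "length w + 2 \<le> 2 ^ ell (length w)" by (simp only: ell_least)
    then show ?thesis by (intro accepted_iff_DCL) simp
  qed
  then have "DCL zo_circuit \<in> DLOGTIME" using accepted_in_DLOGTIME by simp
  then show "{replicate n False @ replicate n True | n. n \<ge> 0} \<in> uniform_TC0"
    unfolding uniform_TC0_def zo_language[symmetric] using zo_TC0_family by blast
  show "\<not> (\<exists>\<sigma> :: bool fm. sentence \<sigma> \<and>
      fm_lang \<sigma> = {replicate n False @ replicate n True | n. n \<ge> 0})"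
    using zeros_ones_not_definable by blast
qed

end
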